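(* Let $a:=\pi\cdot\sqrt{\frac{\sqrt{17}-1}{2}}$. For each $T>0$ there is a smooth function $f$ with $\ell(c_f)=T$ such that for each $r\in(0,T/a)$ the curve $c_{f,r}$ is not injective.
   Context: For a real function $f$ on a compact interval $[0,\lambda]$, $c_f:[0,T(f)]\to\mathbb{R}^2$ denotes the injective arclength-parametrized curve with $c_f(0)=(0,f(0))$ whose image is the graph of $f$; $\ell(c_f)=T(f)$ is its length. For $r>0$, $\mathbb{S}^2(r)$ is the sphere of radius $r$ centered at $0$ in $\mathbb{R}^3$, with a fixed orientation, and $c_{f,r}:[0,T(f)]\to\mathbb{S}^2(r)$ is the curve with $c_{f,r}(0)=(r,0,0)$, $c_{f,r}'(0)=(0,1,0)$, $\|c_{f,r}'(t)\|=1$ and $\kappa_{c_{f,r}}(t)=\kappa_{c_f}(t)$ for all $t\in[0,T(f)]$, where $\kappa$ denotes the signed (geodesic) curvature in $\mathbb{S}^2(r)$ resp. $\mathbb{R}^2$. *)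

theory Defs
  imports "HOL-Analysis.Analysis"
begin

unbundle cross3_syntax

text \<open>
  All derivatives on a compact interval are taken within that interval, i.e. they are one-sided
  at the end points; values of functions outside the interval are irrelevant throughout.
\<close>

definition nth_deriv_on :: "real set \<Rightarrow> nat \<Rightarrow> (real \<Rightarrow> 'a::real_normed_vector) \<Rightarrow> real \<Rightarrow> 'a" where
  "nth_deriv_on S k g = ((\<lambda>h t. vector_derivative h (at t within S)) ^^ k) g"

definition Ck_on :: "nat \<Rightarrow> real set \<Rightarrow> (real \<Rightarrow> 'a::real_normed_vector) \<Rightarrow> bool" where
  "Ck_on k S g \<longleftrightarrow>
     (\<forall>j<k. \<forall>t\<in>S. nth_deriv_on S j g differentiable (at t within S)) \<and>
     continuous_on S (nth_deriv_on S k g)"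

definition smooth_on :: "real set \<Rightarrow> (real \<Rightarrow> 'a::real_normed_vector) \<Rightarrow> bool" where
  "smooth_on S g \<longleftrightarrow> (\<forall>k. Ck_on k S g)"

definition unit_speed_on :: "real set \<Rightarrow> (real \<Rightarrow> 'a::real_normed_vector) \<Rightarrow> bool" where
  "unit_speed_on S c \<longleftrightarrow> (\<forall>t\<in>S. norm (nth_deriv_on S 1 c t) = 1)"

definition curve_length :: "real \<Rightarrow> (real \<Rightarrow> 'a::real_normed_vector) \<Rightarrow> real" where
  "curve_length L c = integral {0..L} (\<lambda>t. norm (nth_deriv_on {0..L} 1 c t))"

text \<open>Signed curvature of a regular plane curve, for the standard orientation of the plane.\<close>

definition plane_curvature :: "real set \<Rightarrow> (real \<Rightarrow> real^2) \<Rightarrow> real \<Rightarrow> real" where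
  "plane_curvature S c t =
     (let v = nth_deriv_on S 1 c t; w = nth_deriv_on S 2 c t
      in (v$1 * w$2 - v$2 * w$1) / norm v ^ 3)"

text \<open>
  Signed geodesic curvature of a regular curve on the sphere of radius \<open>r\<close> centred at the origin,
  oriented by its outward unit normal \<open>\<nu> = c t / r\<close>.  The vector \<open>\<nu> \<times> v\<close> is \<open>v\<close> rotated by a
  positive right angle in the tangent plane.  It is tangential, so pairing it with \<open>w\<close> gives the
  same value as pairing it with the covariant derivative of the velocity, which is the tangential
  part of \<open>w\<close>.
\<close>

definition sphere_curvature :: "real \<Rightarrow> real set \<Rightarrow> (real \<Rightarrow> real^3) \<Rightarrow> real \<Rightarrow> real" where
  "sphere_curvature r S c t =
     (let v = nth_deriv_on S 1 c t; w = nth_deriv_on S 2 c t; \<nu> = (1 / r) *\<^sub>R c t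
      in (w \<bullet> (\<nu> \<times> v)) / norm v ^ 3)"

text \<open>
  \<open>graph_curve lam f L c\<close>: the curve \<open>c\<close> on \<open>{0..L}\<close> is the injective arclength parametrization,
  starting at the left end point, of the graph of \<open>f\<close> over \<open>{0..lam}\<close>.  This determines \<open>L\<close>, and
  \<open>c\<close> on \<open>{0..L}\<close>, from \<open>lam\<close> and \<open>f\<close>.
\<close>

definition graph_curve :: "real \<Rightarrow> (real \<Rightarrow> real) \<Rightarrow> real \<Rightarrow> (real \<Rightarrow> real^2) \<Rightarrow> bool" where
  "graph_curve lam f L c \<longleftrightarrow>
     0 \<le> L \<and> Ck_on 2 {0..L} c \<and> unit_speed_on {0..L} c \<and> inj_on c {0..L} \<and>
     c 0 = vector [0, f 0] \<and> c ` {0..L} = (\<lambda>x. vector [x, f x]) ` {0..lam}"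

text \<open>
  \<open>sphere_curve r L c \<gamma>\<close>: the curve \<open>\<gamma>\<close> on \<open>{0..L}\<close> lies on the sphere of radius \<open>r\<close>, has the
  prescribed initial position and velocity, unit speed, and the same signed curvature as the plane
  curve \<open>c\<close>.  This determines \<open>\<gamma>\<close> on \<open>{0..L}\<close>.
\<close>

definition sphere_curve ::
    "real \<Rightarrow> real \<Rightarrow> (real \<Rightarrow> real^2) \<Rightarrow> (real \<Rightarrow> real^3) \<Rightarrow> bool" where
  "sphere_curve r L c \<gamma> \<longleftrightarrow>
     Ck_on 2 {0..L} \<gamma> \<and> \<gamma> ` {0..L} \<subseteq> sphere 0 r \<and>
     \<gamma> 0 = vector [r, 0, 0] \<and> nth_deriv_on {0..L} 1 \<gamma> 0 = vector [0, 1, 0] \<and>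
     unit_speed_on {0..L} \<gamma> \<and>
     (\<forall>t\<in>{0..L}. sphere_curvature r {0..L} \<gamma> t = plane_curvature {0..L} c t)"

end

theory Submission
  imports Defs
begin

text \<open>
  Take for \<open>f\<close> a catenary, a smooth curve that almost folds back on itself.  Its curvature is even
  about the midpoint, so the spherical curve is symmetric under reflection in the plane through the
  origin orthogonal to its midpoint velocity \<open>e\<close>; it is therefore not injective as soon as its second
  half meets this plane again.  Along the second half let \<open>p\<close> be the component of the normalised
  position in direction \<open>e\<close>, and suppose \<open>p > 0\<close> throughout.  Undoing the rotation of the plane
  tangent, which makes the angle \<open>\<theta>\<close> with the midpoint tangent, turns the frame components into
  \<open>(p, A, B)\<close> with \<open>A' = -p cos \<theta> / r\<close>, \<open>B' = -p sin \<theta> / r\<close> and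
  \<open>p' = (A cos \<theta> + B sin \<theta>) / r\<close>.  With the height \<open>h\<close> of the catenary (so \<open>h' = sin \<theta>\<close>) the
  combination \<open>E = p cos (c - h/r) + B sin (c - h/r)\<close> satisfies
  \<open>E' = A cos \<theta> cos (c - h/r) / r\<close>.  For large \<open>r\<close> (relative to the catenary) \<open>A\<close> stays close to 1
  while the width \<open>\<integral> cos \<theta>\<close> of the catenary is concentrated, logarithmically, near the vertex; with a
  height of \<open>3/5 \<pi> r\<close> this makes \<open>p\<close> negative.  For the remaining \<open>r\<close> either \<open>A \<ge> 0\<close> up to
  arclength \<open>\<pi> r\<close> and Sturm comparison with \<open>sin (s/r)\<close> applies, or \<open>A < 0\<close> from there on and \<open>E\<close>
  decreases, which gives \<open>p \<le> B \<le> 0\<close> after the height has grown by \<open>\<pi> r / 2\<close>.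
\<close>

section \<open>Linear differential equations\<close>

text \<open>Picard iteration: the iterates are bounded by the terms of an exponential series.\<close>

lemma linear_ode_solution:
  fixes F :: "real \<Rightarrow> 'a::banach \<Rightarrow> 'a"
  assumes L: "0 \<le> L"
    and lin: "\<And>t. t \<in> {0..L} \<Longrightarrow> bounded_linear (F t)"
    and bound: "\<And>t x. t \<in> {0..L} \<Longrightarrow> norm (F t x) \<le> K * norm x"
    and cont: "\<And>X. continuous_on {0..L} X \<Longrightarrow> continuous_on {0..L} (\<lambda>t. F t (X t))"
  shows "\<exists>X. X 0 = v \<and>
    (\<forall>t\<in>{0..L}. (X has_vector_derivative F t (X t)) (at t within {0..L}))"
proof -
  \<comment> \<open>The \<open>x n\<close> are the successive increments of the Picard
    approximations, so the solution is their sum rather than their limit.\<close>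
  define x where "x = rec_nat (\<lambda>_. v) (\<lambda>_ y t. integral {0..t} (\<lambda>s. F s (y s)))"
  have x_0: "x 0 = (\<lambda>_. v)"
    and x_Suc: "\<And>n. x (Suc n) = (\<lambda>t. integral {0..t} (\<lambda>s. F s (x n s)))"
    by (simp_all add: x_def)
  have deriv_step: "(x (Suc n) has_vector_derivative F t (x n t)) (at t within {0..L})"
    if "continuous_on {0..L} (x n)" "t \<in> {0..L}" for n t
    unfolding x_Suc using that by (intro integral_has_vector_derivative cont)
  have x_cont: "continuous_on {0..L} (x n)" for n
  proof (induction n)
    case (Suc n)
    then show ?case
      using deriv_step[OF Suc] by (intro continuous_on_vector_derivative)
  qed (simp add: x_0)
  note x_deriv = deriv_step[OF x_cont]
  have x_bound: "norm (x n t) \<le> norm v * (K * t) ^ n / fact n" if "t \<in> {0..L}" for n t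
    using that
  proof (induction n arbitrary: t)
    case (Suc n)
    let ?g = "\<lambda>s. K * (norm v * (K * s) ^ n / fact n)"
    have int: "(?g has_integral norm v * (K * t) ^ Suc n / fact (Suc n) - norm v * (K * 0) ^ Suc n / fact (Suc n)) {0..t}"
    proof (rule fundamental_theorem_of_calculus)
      fix s
      have "((\<lambda>s. norm v * (K * s) ^ Suc n / fact (Suc n)) has_real_derivative
          norm v * (real (Suc n) * (K * s) ^ n * K) / fact (Suc n)) (at s within {0..t})"
        using DERIV_power[OF DERIV_cmult_Id[of K s "{0..t}"], of "Suc n"]
        by (intro DERIV_cdivide DERIV_cmult) (simp add: mult_ac del: of_nat_Suc power_Suc)
      moreover have "norm v * (real (Suc n) * (K * s) ^ n * K) / fact (Suc n) = ?g s"
        by (simp del: of_nat_Suc)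
      ultimately show "((\<lambda>s. norm v * (K * s) ^ Suc n / fact (Suc n)) has_vector_derivative ?g s) (at s within {0..t})"
        unfolding has_real_derivative_iff_has_vector_derivative by (simp add: mult_ac)
    qed (use Suc.prems in simp)
    have "norm (x (Suc n) t) \<le> integral {0..t} ?g"
      unfolding x_Suc
    proof (rule integral_norm_bound_integral)
      show "(\<lambda>s. F s (x n s)) integrable_on {0..t}"
        using continuous_on_subset[OF cont[OF x_cont]] Suc.prems
        by (intro integrable_continuous_real) auto
      show "?g integrable_on {0..t}" using int by blast
      fix s assume "s \<in> {0..t}"
      then have s: "s \<in> {0..L}" using Suc.prems by simp
      have "norm (F s (x n s)) \<le> K * norm (x n s)" by (rule bound[OF s])
      also have "\<dots> \<le> ?g s"
      \<comment> \<open>A negative \<open>K\<close> is possible only in a trivial space, since norms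
        are nonnegative.\<close>
      proof (cases "K \<ge> 0")
        case True
        then show ?thesis using Suc.IH[OF s] by (intro mult_left_mono)
      next
        case False
        then have zero: "y = 0" for y :: 'a
          using bound[OF s, of y] norm_ge_zero[of "F s y"]
          by (metis mult_less_0_iff norm_le_zero_iff not_le order_trans)
        show ?thesis by (simp add: zero[of v] zero[of "x n s"])
      qed
      finally show "norm (F s (x n s)) \<le> ?g s" .
    qed
    also have "\<dots> = norm v * (K * t) ^ Suc n / fact (Suc n)"
      using integral_unique[OF int] by simp
    finally show ?case .
  qed (simp add: x_0)
  define K' where "K' = \<bar>K\<bar>"
  have x_bound': "norm (x n t) \<le> norm v * ((K' * L) ^ n / fact n)" if t: "t \<in> {0..L}" for n t
  proof -
    have "(K * t) ^ n \<le> \<bar>K * t\<bar> ^ n" by (metis abs_ge_self power_abs)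
    also have "\<dots> \<le> (K' * L) ^ n"
      unfolding K'_def abs_mult using t by (intro power_mono mult_mono) auto
    finally have "norm v * (K * t) ^ n / fact n \<le> norm v * (K' * L) ^ n / fact n"
      by (intro divide_right_mono mult_left_mono) auto
    then show ?thesis using x_bound[OF t, of n] by simp
  qed
  have summable: "summable (\<lambda>n. norm v * ((K' * L) ^ n / fact n))"
    using summable_exp_generic[of "K' * L"]
    by (intro summable_mult) (simp add: divide_inverse mult.commute)
  define X where "X t = (\<Sum>n. x n t)" for t
  have sums: "(\<lambda>n. x n t) sums X t" if "t \<in> {0..L}" for t
    unfolding X_def using x_bound'[OF that] summable
    by (intro summable_sums summable_comparison_test'[OF summable]) auto
  have Fsums: "(\<lambda>n. F t (x n t)) sums F t (X t)" if "t \<in> {0..L}" for t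
    by (rule bounded_linear.sums[OF lin[OF that] sums[OF that]])
  \<comment> \<open>The derivative of each increment is \<open>F\<close> applied to the previous
    one, and that of the constant increment 0 is zero; hence the series of derivatives sums to
    \<open>F t (X t)\<close>.\<close>
  define x' where "x' n t = (case n of 0 \<Rightarrow> 0 | Suc m \<Rightarrow> F t (x m t))" for n t
  have x': "(x n has_derivative (\<lambda>h. h *\<^sub>R x' n t)) (at t within {0..L})" if "t \<in> {0..L}" for n t
  proof (cases n)
    case (Suc m)
    then show ?thesis
      using x_deriv[OF that, of m] by (simp add: x'_def has_vector_derivative_def)
  qed (simp add: x_0 x'_def)
  have x'_sums: "(\<lambda>n. x' n t) sums F t (X t)" if "t \<in> {0..L}" for t
    using Fsums[OF that] sums_Suc_iff[of "\<lambda>n. x' n t" "F t (X t)"] by (simp add: x'_def)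
  have x'_bound: "norm (x' (Suc n) t) \<le> K' * (norm v * ((K' * L) ^ n / fact n))"
    if t: "t \<in> {0..L}" for n t
  proof -
    have "norm (x' (Suc n) t) \<le> K * norm (x n t)" using bound[OF t] by (simp add: x'_def)
    also have "\<dots> \<le> K' * norm (x n t)" unfolding K'_def by (intro mult_right_mono) auto
    also have "\<dots> \<le> K' * (norm v * ((K' * L) ^ n / fact n))"
      using x_bound'[OF t] by (intro mult_left_mono) (auto simp: K'_def)
    finally show ?thesis .
  qed
  define M where "M n = (case n of 0 \<Rightarrow> 0 | Suc m \<Rightarrow> K' * (norm v * ((K' * L) ^ m / fact m)))" for n
  have M_bound: "norm (x' n t) \<le> M n" if "t \<in> {0..L}" for n t
    using x'_bound[OF that] by (cases n) (auto simp: M_def x'_def)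
  have "summable (\<lambda>n. M (Suc n))" unfolding M_def using summable_mult[OF summable, of K'] by simp
  then have "summable M" by (simp only: summable_Suc_iff)
  then have "uniform_limit {0..L} (\<lambda>n t. \<Sum>i<n. x' i t) (\<lambda>t. \<Sum>i. x' i t) sequentially"
    using M_bound by (intro Weierstrass_m_test)
  then have unif: "uniform_limit {0..L} (\<lambda>n t. \<Sum>i<n. x' i t) (\<lambda>t. F t (X t)) sequentially"
    by (rule uniform_limit_cong'[THEN iffD1, rotated -1]) (use x'_sums in \<open>auto simp: sums_iff\<close>)
  \<comment> \<open>Termwise differentiation, justified by the uniform convergence just shown. The
    resulting \<open>g\<close> is identified with \<open>X\<close> on the interval
    afterwards.\<close>
  have "\<exists>g. \<forall>t\<in>{0..L}. (\<lambda>n. x n t) sums g t \<and> (g has_derivative (\<lambda>h. h *\<^sub>R F t (X t))) (at t within {0..L})"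
  proof (rule has_derivative_series)
    fix e :: real assume "e > 0"
    then have "\<forall>\<^sub>F n in sequentially. \<forall>t\<in>{0..L}. dist (\<Sum>i<n. x' i t) (F t (X t)) < e"
      using unif by (simp add: uniform_limit_iff)
    then show "\<forall>\<^sub>F n in sequentially. \<forall>t\<in>{0..L}. \<forall>h. norm ((\<Sum>i<n. h *\<^sub>R x' i t) - h *\<^sub>R F t (X t)) \<le> e * norm h"
    proof eventually_elim
      case (elim n)
      show ?case
      proof (intro ballI allI)
        fix t h assume "t \<in> {0..L}"
        then have "\<bar>h\<bar> * norm ((\<Sum>i<n. x' i t) - F t (X t)) \<le> \<bar>h\<bar> * e"
          using elim by (intro mult_left_mono) (auto simp: dist_norm intro: less_imp_le)
        then show "norm ((\<Sum>i<n. h *\<^sub>R x' i t) - h *\<^sub>R F t (X t)) \<le> e * norm h"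
          by (simp add: scaleR_sum_right[symmetric] scaleR_diff_right[symmetric] mult.commute)
      qed
    qed
  qed (use L x' sums[of 0] in auto)
  then obtain g where g: "\<And>t. t \<in> {0..L} \<Longrightarrow> (\<lambda>n. x n t) sums g t"
      "\<And>t. t \<in> {0..L} \<Longrightarrow> (g has_derivative (\<lambda>h. h *\<^sub>R F t (X t))) (at t within {0..L})"
    by blast
  have gX: "g t = X t" if "t \<in> {0..L}" for t
    using sums_unique2[OF g(1) sums] that by blast
  have "x n 0 = (if n = 0 then v else 0)" for n by (cases n) (simp_all add: x_0 x_Suc)
  then have "(\<lambda>n. if n = 0 then v else 0) sums g 0" using g(1)[of 0] L by simp
  then have "g 0 = v" using sums_unique2 sums_single[of 0 "\<lambda>_. v"] by fastforce
  moreover have "(g has_vector_derivative F t (g t)) (at t within {0..L})" if "t \<in> {0..L}" for t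
    using g(2)[OF that] gX[OF that] by (simp add: has_vector_derivative_def)
  ultimately show ?thesis by blast
qed

section \<open>Frames of spherical curves\<close>

lemma has_real_derivative_inner:
  fixes f g :: "real \<Rightarrow> 'a::real_inner"
  assumes "(f has_vector_derivative f') (at t within S)" "(g has_vector_derivative g') (at t within S)"
  shows "((\<lambda>t. f t \<bullet> g t) has_real_derivative f' \<bullet> g t + f t \<bullet> g') (at t within S)"
  using bounded_bilinear.has_vector_derivative[OF bounded_bilinear_inner assms]
  by (simp add: has_real_derivative_iff_has_vector_derivative add.commute)

lemma has_vector_derivative_cross3:
  fixes f g :: "real \<Rightarrow> real^3"
  assumes "(f has_vector_derivative f') (at t within S)" "(g has_vector_derivative g') (at t within S)"
  shows "((\<lambda>t. f t \<times> g t) has_vector_derivative f t \<times> g' + f' \<times> g t) (at t within S)"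
  by (rule bounded_bilinear.has_vector_derivative[OF _ assms])
     (simp add: bilinear_cross bilinear_conv_bounded_bilinear[symmetric])

lemma inner_deriv_of_constant:
  fixes f g :: "real \<Rightarrow> 'a::real_inner"
  assumes "0 < T" "t \<in> {0..T}"
    and "(f has_vector_derivative f') (at t within {0..T})"
    and "(g has_vector_derivative g') (at t within {0..T})"
    and const: "\<And>s. s \<in> {0..T} \<Longrightarrow> f s \<bullet> g s = k"
  shows "f' \<bullet> g t + f t \<bullet> g' = 0"
proof -
  have "((\<lambda>t. f t \<bullet> g t) has_vector_derivative f' \<bullet> g t + f t \<bullet> g') (at t within {0..T})"
    using has_real_derivative_inner[OF assms(3,4)]
    by (simp add: has_real_derivative_iff_has_vector_derivative)
  moreover have "((\<lambda>t. f t \<bullet> g t) has_vector_derivative 0) (at t within {0..T})"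
    by (rule has_vector_derivative_transform[OF assms(2) const]) auto
  ultimately show ?thesis
    using vector_derivative_within_closed_interval[OF assms(1,2)] by metis
qed

lemma within_deriv_zero_imp_eq:
  fixes f :: "real \<Rightarrow> real"
  assumes "\<And>x. x \<in> {a..b} \<Longrightarrow> (f has_real_derivative 0) (at x within {a..b})" "x \<in> {a..b}" "y \<in> {a..b}"
  shows "f x = f y"
  using has_field_derivative_zero_constant[of "{a..b}" f] assms by fastforce

text \<open>The remainder \<open>y\<close> is orthogonal to \<open>u\<close> and \<open>v\<close>,
  hence parallel to \<open>u \<times> v\<close> by Lagrange's identity; being orthogonal to that
  unit vector as well, it vanishes.\<close>

lemma orthonormal_cross_expansion:
  fixes u v x :: "real^3"
  assumes "u \<bullet> u = 1" "v \<bullet> v = 1" "u \<bullet> v = 0"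
  shows "x = (x \<bullet> u) *\<^sub>R u + (x \<bullet> v) *\<^sub>R v + (x \<bullet> (u \<times> v)) *\<^sub>R (u \<times> v)"
proof -
  have n1: "(u \<times> v) \<bullet> (u \<times> v) = 1"
    using norm_cross_dot[of u v] assms by (simp add: power2_norm_eq_inner power_mult_distrib)
  define y where "y = x - ((x \<bullet> u) *\<^sub>R u + (x \<bullet> v) *\<^sub>R v + (x \<bullet> (u \<times> v)) *\<^sub>R (u \<times> v))"
  have "y \<bullet> u = 0" "y \<bullet> v = 0" and yn: "y \<bullet> (u \<times> v) = 0"
    using assms n1 by (simp_all add: y_def inner_simps dot_cross_self inner_commute)
  then have "y \<times> (u \<times> v) = 0" by (simp add: Lagrange)
  with yn have "y = 0 \<or> u \<times> v = 0" using norm_and_cross_eq_0 by blast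
  with n1 have "y = 0" by auto
  then show ?thesis by (simp add: y_def)
qed

text \<open>The Darboux frame of a unit-speed curve on the sphere of radius \<open>r\<close>:
  outward normal \<open>u\<close>, tangent \<open>v\<close>, conormal \<open>n\<close>, geodesic
  curvature \<open>\<kappa>\<close>. Orthonormality is asked at time 0 alone and \<open>n\<close>
  has its own equation, so any solution of the linear system fits directly.\<close>

locale sphere_frame =
  fixes r T :: real and \<kappa> :: "real \<Rightarrow> real" and u v n :: "real \<Rightarrow> real^3"
  assumes r_pos: "0 < r" and T_pos: "0 < T"
    and u_deriv: "t \<in> {0..T} \<Longrightarrow> (u has_vector_derivative (1 / r) *\<^sub>R v t) (at t within {0..T})"
    and v_deriv: "t \<in> {0..T} \<Longrightarrow>
      (v has_vector_derivative \<kappa> t *\<^sub>R n t - (1 / r) *\<^sub>R u t) (at t within {0..T})"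
    and n_deriv: "t \<in> {0..T} \<Longrightarrow> (n has_vector_derivative - (\<kappa> t *\<^sub>R v t)) (at t within {0..T})"
    and uu_0: "u 0 \<bullet> u 0 = 1" and vv_0: "v 0 \<bullet> v 0 = 1" and uv_0: "u 0 \<bullet> v 0 = 0"
    and n_0: "n 0 = u 0 \<times> v 0"
begin

text \<open>The frame equation has a skew-symmetric coefficient matrix, so the squared Frobenius
  norm of the Gram matrix minus the identity is conserved; it is zero at time 0.\<close>

lemma orthonormal:
  assumes t: "t \<in> {0..T}"
  shows "u t \<bullet> u t = 1" "v t \<bullet> v t = 1" "n t \<bullet> n t = 1"
    "u t \<bullet> v t = 0" "u t \<bullet> n t = 0" "v t \<bullet> n t = 0"
proof -
  define g1 g2 g3 g4 g5 g6 where "g1 t = u t \<bullet> u t - 1" and "g2 t = v t \<bullet> v t - 1"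
    and "g3 t = n t \<bullet> n t - 1" and "g4 t = u t \<bullet> v t" and "g5 t = u t \<bullet> n t" and "g6 t = v t \<bullet> n t" for t
  have d: "(g1 has_real_derivative 2 * g4 t / r) (at t within {0..T})"
      "(g2 has_real_derivative 2 * \<kappa> t * g6 t - 2 * g4 t / r) (at t within {0..T})"
      "(g3 has_real_derivative - 2 * \<kappa> t * g6 t) (at t within {0..T})"
      "(g4 has_real_derivative (g2 t - g1 t) / r + \<kappa> t * g5 t) (at t within {0..T})"
      "(g5 has_real_derivative g6 t / r - \<kappa> t * g4 t) (at t within {0..T})"
      "(g6 has_real_derivative \<kappa> t * (g3 t - g2 t) - g5 t / r) (at t within {0..T})"
    if t: "t \<in> {0..T}" for t
    unfolding g1_def g2_def g3_def g4_def g5_def g6_def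
    by (rule DERIV_cong, (rule DERIV_diff has_real_derivative_inner u_deriv[OF t] v_deriv[OF t]
        n_deriv[OF t] DERIV_const)+,
        simp add: inner_diff_left inner_diff_right inner_commute diff_divide_distrib algebra_simps)+
  \<comment> \<open>Off-diagonal Gram entries occur twice, hence the factor 2.\<close>
  let ?E = "\<lambda>t. (g1 t)\<^sup>2 + (g2 t)\<^sup>2 + (g3 t)\<^sup>2 + 2 * ((g4 t)\<^sup>2 + (g5 t)\<^sup>2 + (g6 t)\<^sup>2)"
  have "?E t = ?E 0"
  proof (rule within_deriv_zero_imp_eq[OF _ t])
    fix t assume "t \<in> {0..T}"
    note d = d[OF this]
    show "(?E has_real_derivative 0) (at t within {0..T})"
      by (rule DERIV_cong, (rule DERIV_add DERIV_cmult DERIV_power d)+)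
         (simp add: algebra_simps diff_divide_distrib add_divide_distrib)
  qed (use T_pos in auto)
  also have "?E 0 = 0"
    using norm_cross_dot[of "u 0" "v 0"] uu_0 vv_0 uv_0
    by (simp add: g1_def g2_def g3_def g4_def g5_def g6_def n_0 dot_cross_self power2_norm_eq_inner
        power_mult_distrib)
  finally have E: "?E t = 0" .
  have "g1 t = 0 \<and> g2 t = 0 \<and> g3 t = 0 \<and> g4 t = 0 \<and> g5 t = 0 \<and> g6 t = 0"
    using E by (simp add: add_nonneg_eq_0_iff)
  then show "u t \<bullet> u t = 1" "v t \<bullet> v t = 1" "n t \<bullet> n t = 1"
    "u t \<bullet> v t = 0" "u t \<bullet> n t = 0" "v t \<bullet> n t = 0"
    by (simp_all add: g1_def g2_def g3_def g4_def g5_def g6_def)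
qed

text \<open>The triple product is constant along the frame, with value 1, and two unit vectors with
  inner product 1 coincide.\<close>

lemma n_eq_cross:
  assumes t: "t \<in> {0..T}"
  shows "n t = u t \<times> v t"
proof -
  have "n t \<bullet> (u t \<times> v t) = n 0 \<bullet> (u 0 \<times> v 0)"
  proof (rule within_deriv_zero_imp_eq[OF _ t])
    fix t assume t: "t \<in> {0..T}"
    show "((\<lambda>t. n t \<bullet> (u t \<times> v t)) has_real_derivative 0) (at t within {0..T})"
      by (rule DERIV_cong, rule has_real_derivative_inner[OF n_deriv[OF t]
            has_vector_derivative_cross3[OF u_deriv[OF t] v_deriv[OF t]]])
         (simp add: dot_cross_self cross_mult_left cross_mult_right Cross3.right_diff_distrib inner_simps)
  qed (use T_pos in auto)
  also have "\<dots> = 1" using orthonormal(3)[of 0] T_pos by (simp add: n_0)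
  finally have "n t \<bullet> (u t \<times> v t) = 1" .
  moreover have "(u t \<times> v t) \<bullet> (u t \<times> v t) = 1"
    using norm_cross_dot[of "u t" "v t"] orthonormal[OF t]
    by (simp add: power2_norm_eq_inner power_mult_distrib)
  ultimately have "(n t - u t \<times> v t) \<bullet> (n t - u t \<times> v t) = 0"
    using orthonormal(3)[OF t] by (simp add: inner_diff_left inner_diff_right inner_commute)
  then show ?thesis by simp
qed

lemma inner_expansion:
  assumes t: "t \<in> {0..T}"
  shows "x \<bullet> y = (u t \<bullet> x) * (u t \<bullet> y) + (v t \<bullet> x) * (v t \<bullet> y) + (n t \<bullet> x) * (n t \<bullet> y)"
  using arg_cong[OF orthonormal_cross_expansion[of "u t" "v t" x], of "\<lambda>z. z \<bullet> y"] orthonormal[OF t]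
  by (simp add: inner_simps n_eq_cross[OF t] inner_commute)

text \<open>
  Reversing time turns the frame of a curve with even curvature into the frame of its reflection
  in the plane orthogonal to the midpoint velocity.
\<close>

lemma reflection:
  assumes sym: "\<And>t. t \<in> {0..T} \<Longrightarrow> \<kappa> (T - t) = \<kappa> t"
    and s: "s \<in> {0..T/2}"
  shows "(u (T/2 + s) \<bullet> x) * (u (T/2 - s) \<bullet> y) - (v (T/2 + s) \<bullet> x) * (v (T/2 - s) \<bullet> y)
      + (n (T/2 + s) \<bullet> x) * (n (T/2 - s) \<bullet> y) = x \<bullet> y - 2 * (v (T/2) \<bullet> x) * (v (T/2) \<bullet> y)"
proof -
  let ?m = "T / 2"
  let ?Q = "\<lambda>s. (u (?m + s) \<bullet> x) * (u (?m - s) \<bullet> y) - (v (?m + s) \<bullet> x) * (v (?m - s) \<bullet> y)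
      + (n (?m + s) \<bullet> x) * (n (?m - s) \<bullet> y)"
  have plus: "((\<lambda>s. f (?m + s) \<bullet> z) has_real_derivative f' \<bullet> z) (at s within {0..?m})"
    if "(f has_vector_derivative f') (at (?m + s) within {0..T})" for f f' s and z :: "real^3"
  proof -
    have "((\<lambda>s. f (?m + s)) has_vector_derivative 1 *\<^sub>R f') (at s within {0..?m})"
      by (rule vector_diff_chain_within[of "\<lambda>s. ?m + s", unfolded o_def])
         (auto intro!: derivative_eq_intros has_vector_derivative_within_subset[OF that])
    from has_real_derivative_inner[OF this has_vector_derivative_const, of z] show ?thesis by simp
  qed
  have minus: "((\<lambda>s. f (?m - s) \<bullet> z) has_real_derivative - (f' \<bullet> z)) (at s within {0..?m})"
    if "(f has_vector_derivative f') (at (?m - s) within {0..T})" for f f' s and z :: "real^3"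
  proof -
    have "((\<lambda>s. f (?m - s)) has_vector_derivative (- 1) *\<^sub>R f') (at s within {0..?m})"
      by (rule vector_diff_chain_within[of "\<lambda>s. ?m - s", unfolded o_def])
         (auto intro!: derivative_eq_intros has_vector_derivative_within_subset[OF that])
    from has_real_derivative_inner[OF this has_vector_derivative_const, of z] show ?thesis by simp
  qed
  \<comment> \<open>Running backwards flips the sign of each derivative at \<open>?m - s\<close>;
    with the minus sign of the \<open>v\<close> term and the evenness of \<open>\<kappa>\<close> all
    terms cancel.\<close>
  have "?Q s = ?Q 0"
  proof (rule within_deriv_zero_imp_eq[OF _ s])
    fix s assume s: "s \<in> {0..?m}"
    then have p: "?m + s \<in> {0..T}" and m: "?m - s \<in> {0..T}" by auto
    have k: "\<kappa> (?m - s) = \<kappa> (?m + s)" using sym[OF p] by (simp add: field_simps)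
    show "(?Q has_real_derivative 0) (at s within {0..?m})"
      by (rule DERIV_cong, (rule DERIV_add DERIV_diff DERIV_mult plus minus
            u_deriv[OF p] v_deriv[OF p] n_deriv[OF p] u_deriv[OF m] v_deriv[OF m] n_deriv[OF m])+)
         (simp add: k inner_simps algebra_simps)
  qed (use T_pos in auto)
  also have "?Q 0 = x \<bullet> y - 2 * (v ?m \<bullet> x) * (v ?m \<bullet> y)"
    using inner_expansion[of ?m x y] T_pos by simp
  finally show ?thesis .
qed

text \<open>Put \<open>x = u (T/2 + s)\<close> in the reflection identity: orthonormality leaves
  only the \<open>u\<close> term on the left, and the orthogonality assumption removes the
  correction on the right.\<close>

lemma self_intersection:
  assumes sym: "\<And>t. t \<in> {0..T} \<Longrightarrow> \<kappa> (T - t) = \<kappa> t"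
    and s: "s \<in> {0..T/2}" and orth: "u (T/2 + s) \<bullet> v (T/2) = 0"
  shows "u (T/2 - s) = u (T/2 + s)"
proof -
  have "u (T/2 - s) \<bullet> y = u (T/2 + s) \<bullet> y" for y
    using reflection[OF sym s, of "u (T/2 + s)" y] orthonormal[of "T/2 + s"] s orth
    by (simp add: inner_commute)
  then show ?thesis using vector_eq_rdot by blast
qed

end

section \<open>Existence and frames of curves with prescribed curvature\<close>

lemma nth_deriv_on_0: "nth_deriv_on S 0 g = g"
  and nth_deriv_on_Suc:
    "nth_deriv_on S (Suc k) g = (\<lambda>t. vector_derivative (nth_deriv_on S k g) (at t within S))"
  by (simp_all add: nth_deriv_on_def)

lemma nth_deriv_on_eq:
  fixes G :: "nat \<Rightarrow> real \<Rightarrow> 'a::euclidean_space"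
  assumes "a < b"
    and "\<And>j t. j < k \<Longrightarrow> t \<in> {a..b} \<Longrightarrow> (G j has_vector_derivative G (Suc j) t) (at t within {a..b})"
    and "t \<in> {a..b}"
  shows "nth_deriv_on {a..b} k (G 0) t = G k t"
  using assms(2,3)
proof (induction k arbitrary: t)
  case (Suc k)
  have "(nth_deriv_on {a..b} k (G 0) has_vector_derivative G (Suc k) t) (at t within {a..b})"
    by (rule has_vector_derivative_transform[OF Suc.prems(2), of _ "G k"])
       (use Suc in \<open>auto simp: less_Suc_eq\<close>)
  then show ?case
    unfolding nth_deriv_on_Suc by (rule vector_derivative_within_closed_interval[OF assms(1) Suc.prems(2)])
qed (simp add: nth_deriv_on_0)

lemma Ck_on_I:
  fixes G :: "nat \<Rightarrow> real \<Rightarrow> 'a::euclidean_space"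
  assumes "a < b"
    and G: "\<And>j t. j < k \<Longrightarrow> t \<in> {a..b} \<Longrightarrow> (G j has_vector_derivative G (Suc j) t) (at t within {a..b})"
    and "continuous_on {a..b} (G k)"
  shows "Ck_on k {a..b} (G 0)"
proof -
  have eq: "nth_deriv_on {a..b} j (G 0) t = G j t" if "j \<le> k" "t \<in> {a..b}" for j t
    using that by (intro nth_deriv_on_eq assms) auto
  have "nth_deriv_on {a..b} j (G 0) differentiable at t within {a..b}" if "j < k" "t \<in> {a..b}" for j t
    using has_vector_derivative_transform[OF that(2) eq G[OF that]] that
    by (auto intro: differentiableI_vector)
  moreover have "continuous_on {a..b} (nth_deriv_on {a..b} k (G 0))"
    using assms(3) eq by (subst continuous_on_cong[of _ "{a..b}" _ "G k"]) auto
  ultimately show ?thesis by (simp add: Ck_on_def)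
qed

lemma C2_on_I:
  fixes c :: "real \<Rightarrow> 'a::euclidean_space"
  assumes "a < b"
    and "\<And>t. t \<in> {a..b} \<Longrightarrow> (c has_vector_derivative c1 t) (at t within {a..b})"
    and "\<And>t. t \<in> {a..b} \<Longrightarrow> (c1 has_vector_derivative c2 t) (at t within {a..b})"
    and "continuous_on {a..b} c2"
  shows "Ck_on 2 {a..b} c" "\<And>t. t \<in> {a..b} \<Longrightarrow> nth_deriv_on {a..b} 1 c t = c1 t"
    "\<And>t. t \<in> {a..b} \<Longrightarrow> nth_deriv_on {a..b} 2 c t = c2 t"
proof -
  define G where "G j = [c, c1, c2] ! j" for j
  have G: "(G j has_vector_derivative G (Suc j) t) (at t within {a..b})"
    if "j < 2" "t \<in> {a..b}" for j t
    using that assms(2,3) by (auto simp: G_def less_Suc_eq numeral_2_eq_2)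
  show "Ck_on 2 {a..b} c"
    using Ck_on_I[of a b 2 G] assms G by (simp add: G_def numeral_2_eq_2)
  show "nth_deriv_on {a..b} 1 c t = c1 t" if "t \<in> {a..b}" for t
  proof -
    have "nth_deriv_on {a..b} 1 (G 0) t = G 1 t"
      by (rule nth_deriv_on_eq[where G = G]) (use assms(1) G that in auto)
    then show ?thesis by (simp add: G_def)
  qed
  show "nth_deriv_on {a..b} 2 c t = c2 t" if "t \<in> {a..b}" for t
  proof -
    have "nth_deriv_on {a..b} 2 (G 0) t = G 2 t"
      by (rule nth_deriv_on_eq[where G = G]) (use assms(1) G that in auto)
    then show ?thesis by (simp add: G_def numeral_2_eq_2)
  qed
qed

lemma Ck_on_2_derivs:
  assumes "Ck_on 2 S c" "t \<in> S"
  shows "(c has_vector_derivative nth_deriv_on S 1 c t) (at t within S)"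
    "(nth_deriv_on S 1 c has_vector_derivative nth_deriv_on S 2 c t) (at t within S)"
proof -
  have d: "nth_deriv_on S j c differentiable at t within S" if "j < 2" for j
    using assms that by (simp add: Ck_on_def)
  show "(c has_vector_derivative nth_deriv_on S 1 c t) (at t within S)"
    using d[of 0] by (simp add: nth_deriv_on_Suc nth_deriv_on_0 vector_derivative_works)
  show "(nth_deriv_on S 1 c has_vector_derivative nth_deriv_on S 2 c t) (at t within S)"
    using d[of 1] by (simp add: nth_deriv_on_Suc numeral_2_eq_2 vector_derivative_works)
qed

section \<open>Spherical curves and their frames\<close>

text \<open>Differentiating \<open>u \<bullet> u = 1\<close>, \<open>u \<bullet> v = 0\<close> and
  \<open>v \<bullet> v = 1\<close> yields the components of the acceleration along \<open>u\<close>
  and \<open>v\<close>; the conormal component is the geodesic curvature.\<close>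

lemma sphere_curve_frame:
  assumes "0 < r" "0 < T" and \<gamma>: "sphere_curve r T c \<gamma>"
  defines "u \<equiv> \<lambda>t. (1 / r) *\<^sub>R \<gamma> t" and "v \<equiv> nth_deriv_on {0..T} 1 \<gamma>"
  shows "sphere_frame r T (plane_curvature {0..T} c) u v (\<lambda>t. u t \<times> v t)"
proof -
  define w where "w = nth_deriv_on {0..T} 2 \<gamma>"
  define \<kappa> where "\<kappa> = plane_curvature {0..T} c"
  have u: "(u has_vector_derivative (1 / r) *\<^sub>R v t) (at t within {0..T})"
    and v: "(v has_vector_derivative w t) (at t within {0..T})" if "t \<in> {0..T}" for t
    using Ck_on_2_derivs[of "{0..T}" \<gamma> t] \<gamma> that
    by (auto simp: sphere_curve_def u_def v_def w_def
        intro!: bounded_linear.has_vector_derivative[OF bounded_linear_scaleR_right])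
  have uu: "u t \<bullet> u t = 1" and vv: "v t \<bullet> v t = 1" if "t \<in> {0..T}" for t
  proof -
    have "norm (\<gamma> t) = r" "norm (v t) = 1"
      using \<gamma> that by (auto simp: sphere_curve_def unit_speed_on_def v_def image_subset_iff)
    then show "u t \<bullet> u t = 1" "v t \<bullet> v t = 1"
      using \<open>0 < r\<close> by (simp_all add: u_def dot_square_norm power2_eq_square)
  qed
  have uv: "u t \<bullet> v t = 0" if t: "t \<in> {0..T}" for t
    using inner_deriv_of_constant[OF \<open>0 < T\<close> t u[OF t] u[OF t] uu] \<open>0 < r\<close>
    by (simp add: inner_commute)
  have uw: "u t \<bullet> w t = - (1 / r)" if t: "t \<in> {0..T}" for t
    using inner_deriv_of_constant[OF \<open>0 < T\<close> t u[OF t] v[OF t] uv] vv[OF t]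
    by (simp add: eq_neg_iff_add_eq_0 add.commute)
  have vw: "v t \<bullet> w t = 0" if t: "t \<in> {0..T}" for t
    using inner_deriv_of_constant[OF \<open>0 < T\<close> t v[OF t] v[OF t] vv] by (simp add: inner_commute)
  have nw: "w t \<bullet> (u t \<times> v t) = \<kappa> t" if t: "t \<in> {0..T}" for t
  proof -
    have "norm (v t) = 1" using vv[OF t] by (simp add: norm_eq_1)
    moreover have "sphere_curvature r {0..T} \<gamma> t = \<kappa> t"
      using \<gamma> t by (simp add: sphere_curve_def \<kappa>_def)
    ultimately show ?thesis
      by (simp add: sphere_curvature_def u_def v_def w_def)
  qed
  have w_eq: "w t = \<kappa> t *\<^sub>R (u t \<times> v t) - (1 / r) *\<^sub>R u t" if t: "t \<in> {0..T}" for t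
    using orthonormal_cross_expansion[of "u t" "v t" "w t"] uu[OF t] vv[OF t] uv[OF t] uw[OF t] vw[OF t] nw[OF t]
    by (simp add: inner_commute)
  have zero: "0 \<in> {0..T}" using \<open>0 < T\<close> by simp
  show ?thesis
    unfolding \<kappa>_def[symmetric]
  proof
    fix t assume t: "t \<in> {0..T}"
    show "(u has_vector_derivative (1 / r) *\<^sub>R v t) (at t within {0..T})" by (rule u[OF t])
    show "(v has_vector_derivative \<kappa> t *\<^sub>R u t \<times> v t - (1 / r) *\<^sub>R u t) (at t within {0..T})"
      using v[OF t] w_eq[OF t] by simp
    have "u t \<times> w t + ((1 / r) *\<^sub>R v t) \<times> v t = - (\<kappa> t *\<^sub>R v t)"
      unfolding w_eq[OF t]
      by (simp add: Cross3.right_diff_distrib cross_mult_left cross_mult_right Lagrange uu[OF t] uv[OF t])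
    then show "((\<lambda>t. u t \<times> v t) has_vector_derivative - (\<kappa> t *\<^sub>R v t)) (at t within {0..T})"
      using has_vector_derivative_cross3[OF u[OF t] v[OF t]] by simp
  qed (use assms(1,2) uu vv uv zero in auto)
qed

text \<open>The frame equation is a linear system with continuous coefficients. Its solution stays
  orthonormal, so \<open>r *\<^sub>R u t\<close> lies on the sphere and has unit speed.\<close>

lemma sphere_curve_exists:
  assumes "0 < r" "0 < T" and \<kappa>: "continuous_on {0..T} (plane_curvature {0..T} c)"
  shows "\<exists>\<gamma>. sphere_curve r T c \<gamma>"
proof -
  define \<kappa> where "\<kappa> = plane_curvature {0..T} c"
  have "bounded (\<kappa> ` {0..T})"
    unfolding \<kappa>_def by (intro compact_imp_bounded compact_continuous_image \<kappa>) simp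
  then obtain C where C: "\<And>t. t \<in> {0..T} \<Longrightarrow> \<bar>\<kappa> t\<bar> \<le> C"
    unfolding bounded_iff by (metis imageI real_norm_def)
  define F :: "real \<Rightarrow> (real^3) * (real^3) * (real^3) \<Rightarrow> (real^3) * (real^3) * (real^3)" where
    "F t X = ((1 / r) *\<^sub>R fst (snd X), \<kappa> t *\<^sub>R snd (snd X) - (1 / r) *\<^sub>R fst X, - (\<kappa> t *\<^sub>R fst (snd X)))" for t X
  define X\<^sub>0 :: "(real^3) * (real^3) * (real^3)" where
    "X\<^sub>0 = (vector [1, 0, 0], vector [0, 1, 0], vector [0, 0, 1])"
  have "0 \<le> T" using assms by simp
  moreover have "bounded_linear (F t)" for t
    unfolding F_def
    by (intro bounded_linear_Pair bounded_linear_sub bounded_linear_minus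
        bounded_linear_const_scaleR bounded_linear_fst bounded_linear_snd
        bounded_linear_compose[OF bounded_linear_fst] bounded_linear_compose[OF bounded_linear_snd])
  moreover have "norm (F t X) \<le> (2 / r + 2 * C) * norm X" if "t \<in> {0..T}" for t X
  proof -
    define y z where "y = fst (snd X)" and "z = snd (snd X)"
    have "norm (snd X) \<le> norm X" by (metis norm_snd_le prod.collapse)
    then have le: "norm (fst X) \<le> norm X" "norm y \<le> norm X" "norm z \<le> norm X"
      unfolding y_def z_def
      by (metis norm_fst_le prod.collapse, metis norm_fst_le order_trans prod.collapse,
          metis norm_snd_le order_trans prod.collapse)
    have "norm (F t X) \<le> norm ((1 / r) *\<^sub>R y) + (norm (\<kappa> t *\<^sub>R z - (1 / r) *\<^sub>R fst X) + norm (- (\<kappa> t *\<^sub>R y)))"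
      unfolding F_def y_def z_def by (meson norm_Pair_le order_trans add_left_mono)
    also have "\<dots> \<le> 1 / r * norm y + (\<bar>\<kappa> t\<bar> * norm z + 1 / r * norm (fst X) + \<bar>\<kappa> t\<bar> * norm y)"
      using norm_triangle_ineq4[of "\<kappa> t *\<^sub>R z" "(1 / r) *\<^sub>R fst X"] \<open>0 < r\<close> by simp
    also have "\<dots> \<le> 1 / r * norm X + (C * norm X + 1 / r * norm X + C * norm X)"
      using le C[OF that] \<open>0 < r\<close> by (intro add_mono mult_mono) auto
    finally show ?thesis by (simp add: algebra_simps)
  qed
  moreover have "continuous_on {0..T} (\<lambda>t. F t (X t))" if "continuous_on {0..T} X" for X
    unfolding F_def using that \<kappa> unfolding \<kappa>_def[symmetric] by (intro continuous_intros)
  ultimately have "\<exists>X. X 0 = X\<^sub>0 \<and>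
      (\<forall>t\<in>{0..T}. (X has_vector_derivative F t (X t)) (at t within {0..T}))"
    by (rule linear_ode_solution)
  then obtain X where X_0: "X 0 = X\<^sub>0"
    and X: "\<And>t. t \<in> {0..T} \<Longrightarrow> (X has_vector_derivative F t (X t)) (at t within {0..T})"
    by blast
  define u v n where "u t = fst (X t)" and "v t = fst (snd (X t))" and "n t = snd (snd (X t))" for t
  have snd: "((\<lambda>t. snd (X t)) has_vector_derivative snd (F t (X t))) (at t within {0..T})"
    if "t \<in> {0..T}" for t
    using X[OF that] by (rule bounded_linear.has_vector_derivative[OF bounded_linear_snd])
  have u: "(u has_vector_derivative (1 / r) *\<^sub>R v t) (at t within {0..T})"
    and v: "(v has_vector_derivative \<kappa> t *\<^sub>R n t - (1 / r) *\<^sub>R u t) (at t within {0..T})"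
    and n: "(n has_vector_derivative - (\<kappa> t *\<^sub>R v t)) (at t within {0..T})"
    if "t \<in> {0..T}" for t
    using bounded_linear.has_vector_derivative[OF bounded_linear_fst X[OF that]]
      bounded_linear.has_vector_derivative[OF bounded_linear_fst snd[OF that]]
      bounded_linear.has_vector_derivative[OF bounded_linear_snd snd[OF that]]
    unfolding u_def v_def n_def F_def by simp_all
  interpret sphere_frame r T \<kappa> u v n
    by unfold_locales (use assms u v n in \<open>auto simp: X_0 X\<^sub>0_def u_def v_def n_def cross3_simps\<close>)
  define \<gamma> where "\<gamma> t = r *\<^sub>R u t" for t
  have n_cont: "continuous_on {0..T} n" by (rule continuous_on_vector_derivative[OF n])
  have u_cont: "continuous_on {0..T} u" by (rule continuous_on_vector_derivative[OF u])
  have "(\<gamma> has_vector_derivative v t) (at t within {0..T})" if "t \<in> {0..T}" for t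
    using bounded_linear.has_vector_derivative[OF bounded_linear_scaleR_right[of r] u[OF that]] \<open>0 < r\<close>
    unfolding \<gamma>_def by simp
  moreover have "continuous_on {0..T} (\<lambda>t. \<kappa> t *\<^sub>R n t - (1 / r) *\<^sub>R u t)"
    using \<kappa> n_cont u_cont unfolding \<kappa>_def by (intro continuous_intros)
  ultimately have C2: "Ck_on 2 {0..T} \<gamma>" "\<And>t. t \<in> {0..T} \<Longrightarrow> nth_deriv_on {0..T} 1 \<gamma> t = v t"
      "\<And>t. t \<in> {0..T} \<Longrightarrow> nth_deriv_on {0..T} 2 \<gamma> t = \<kappa> t *\<^sub>R n t - (1 / r) *\<^sub>R u t"
    using C2_on_I[OF \<open>0 < T\<close> _ v] by blast+
  have norm_v: "norm (v t) = 1" if "t \<in> {0..T}" for t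
    using orthonormal(2)[OF that] by (simp add: norm_eq_1)
  have "sphere_curvature r {0..T} \<gamma> t = \<kappa> t" if "t \<in> {0..T}" for t
    using n_eq_cross[OF that] orthonormal[OF that] norm_v[OF that] C2(2,3)[OF that] \<open>0 < r\<close>
    by (simp add: sphere_curvature_def \<gamma>_def inner_simps)
  moreover have "\<gamma> ` {0..T} \<subseteq> sphere 0 r"
    using orthonormal(1) \<open>0 < r\<close> by (auto simp: \<gamma>_def norm_eq_1[symmetric])
  moreover have "\<gamma> 0 = vector [r, 0, 0]" by (simp add: \<gamma>_def u_def X_0 X\<^sub>0_def vec_eq_iff vector_def forall_3)
  moreover have "nth_deriv_on {0..T} 1 \<gamma> 0 = vector [0, 1, 0]"
    using C2(2)[of 0] \<open>0 < T\<close> by (simp add: v_def X_0 X\<^sub>0_def)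
  ultimately show ?thesis
    using C2 norm_v unfolding sphere_curve_def unit_speed_on_def \<kappa>_def by metis
qed

section \<open>The development of half a catenary\<close>

text \<open>Points strictly between \<open>a\<close> and \<open>b\<close> are interior to
  \<open>S\<close>, so the derivative within \<open>S\<close> is an ordinary one there and the mean
  value argument applies.\<close>

lemma within_deriv_nonpos_imp_le:
  fixes f :: "real \<Rightarrow> real"
  assumes "a \<le> b" "{a..b} \<subseteq> S"
    and d: "\<And>x. x \<in> S \<Longrightarrow> (f has_real_derivative f' x) (at x within S)"
    and le: "\<And>x. a < x \<Longrightarrow> x < b \<Longrightarrow> f' x \<le> 0"
  shows "f b \<le> f a"
proof (rule DERIV_nonpos_imp_decreasing_open[OF \<open>a \<le> b\<close>])
  fix x assume x: "a < x" "x < b"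
  then have "x \<in> interior S"
    using assms(2) by (intro interiorI[of "{a<..<b}"]) auto
  then have "at x within S = at x" "x \<in> S"
    using at_within_interior interior_subset by blast+
  then show "\<exists>y. DERIV f x :> y \<and> y \<le> 0"
    using d[of x] le[OF x] by auto
next
  show "continuous_on {a..b} f"
    using assms(2) by (intro DERIV_continuous_on[of _ _ f'] DERIV_subset[OF d]) auto
qed

text \<open>The second half of the spherical curve, with the catenary scaled to curvature
  \<open>1 / (1 + s\<^sup>2)\<close> at arclength \<open>s\<close> from its vertex:
  \<open>p\<close>, \<open>q\<close>, \<open>w\<close> are the components of normalised position,
  velocity and conormal along the midpoint velocity, and \<open>r\<close> is the radius in catenary
  units. \<open>p_pos\<close> is the assumption to be refuted.\<close>

locale catenary_development =
  fixes N r :: real and p q w :: "real \<Rightarrow> real"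
  assumes N_pos: "N > 0" and r_pos: "r > 0"
    and p_deriv: "s \<in> {0..N} \<Longrightarrow> (p has_real_derivative q s / r) (at s within {0..N})"
    and q_deriv: "s \<in> {0..N} \<Longrightarrow>
      (q has_real_derivative w s / (1 + s\<^sup>2) - p s / r) (at s within {0..N})"
    and w_deriv: "s \<in> {0..N} \<Longrightarrow> (w has_real_derivative - (q s / (1 + s\<^sup>2))) (at s within {0..N})"
    and init: "p 0 = 0" "q 0 = 1" "w 0 = 0"
    and p_pos: "s \<in> {0<..N} \<Longrightarrow> p s > 0"
begin

text \<open>The height of the unit catenary at arclength \<open>s\<close> from the vertex. Its
  tangent angle has tangent \<open>s\<close>, hence cosine \<open>1 / h s\<close> and sine
  \<open>s / h s\<close>.\<close>

definition h :: "real \<Rightarrow> real" where "h s = sqrt (1 + s\<^sup>2)"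

lemma h_pos: "h s > 0" and h_sq: "h s * h s = 1 + s\<^sup>2" and h_ne [simp]: "h s \<noteq> 0"
  and h_ge1: "1 \<le> h s"
proof -
  have "0 < 1 + s\<^sup>2" by (simp add: add_pos_nonneg)
  then show "h s > 0" "h s * h s = 1 + s\<^sup>2" unfolding h_def by auto
  then show "h s \<noteq> 0" by simp
  show "1 \<le> h s" by (simp add: h_def)
qed

lemma h_deriv: "(h has_real_derivative s / h s) (at s within S)"
proof -
  have "0 < 1 + s\<^sup>2" using h_pos[of s] unfolding h_def by simp
  then show ?thesis
    unfolding h_def[abs_def] by (auto intro!: derivative_eq_intros simp: field_simps)
qed

text \<open>The frame components with the rotation of the catenary's tangent undone: these evolve
  only because the sphere rolls.\<close>

definition A :: "real \<Rightarrow> real" where "A s = (q s - s * w s) / h s"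
definition B :: "real \<Rightarrow> real" where "B s = (s * q s + w s) / h s"

lemma q_eq: "q s = (A s + s * B s) / h s" and w_eq: "w s = (B s - s * A s) / h s"
proof -
  have ne: "1 + s\<^sup>2 \<noteq> 0" using h_sq[of s] h_ne[of s] by (metis mult_eq_0_iff)
  have "(A s + s * B s) / h s = (1 + s\<^sup>2) * q s / (h s * h s)"
    by (simp add: A_def B_def field_simps power2_eq_square)
  then show "q s = (A s + s * B s) / h s"
    using ne unfolding h_sq by simp
  have "(B s - s * A s) / h s = (1 + s\<^sup>2) * w s / (h s * h s)"
    by (simp add: A_def B_def field_simps power2_eq_square)
  then show "w s = (B s - s * A s) / h s"
    using ne unfolding h_sq by simp
qed

lemma A_deriv:
  assumes "s \<in> {0..N}"
  shows "(A has_real_derivative - (p s / (r * h s))) (at s within {0..N})"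
proof -
  have 1: "1 + s\<^sup>2 = h s * h s" by (simp add: h_sq)
  have "(A has_real_derivative
      ((w s / (h s * h s) - p s / r - (w s - s * (q s / (h s * h s)))) * h s
        - (q s - s * w s) * (s / h s)) / (h s * h s)) (at s within {0..N})"
    unfolding A_def[abs_def]
    using p_deriv[OF assms] q_deriv[OF assms] w_deriv[OF assms] r_pos unfolding 1
    by (auto intro!: derivative_eq_intros h_deriv simp: h_ne)
  \<comment> \<open>The curvature terms collect into a multiple of
    \<open>(1 + s\<^sup>2) - h s * h s\<close>, which is zero.\<close>
  moreover have "((w s / (h s * h s) - p s / r - (w s - s * (q s / (h s * h s)))) * h s
        - (q s - s * w s) * (s / h s)) / (h s * h s) =
       - (p s / (r * h s)) + w s * ((1 + s\<^sup>2) - h s * h s) / (h s * h s * h s)"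
    using r_pos by (simp add: field_simps power2_eq_square)
  ultimately show ?thesis by (simp add: h_sq)
qed

lemma B_deriv:
  assumes "s \<in> {0..N}"
  shows "(B has_real_derivative - (s * p s / (r * h s))) (at s within {0..N})"
proof -
  have 1: "1 + s\<^sup>2 = h s * h s" by (simp add: h_sq)
  have "(B has_real_derivative
      ((q s + s * (w s / (h s * h s) - p s / r) - (q s / (h s * h s))) * h s
        - (s * q s + w s) * (s / h s)) / (h s * h s)) (at s within {0..N})"
    unfolding B_def[abs_def]
    using p_deriv[OF assms] q_deriv[OF assms] w_deriv[OF assms] r_pos unfolding 1
    by (auto intro!: derivative_eq_intros h_deriv simp: h_ne)
  moreover have "((q s + s * (w s / (h s * h s) - p s / r) - (q s / (h s * h s))) * h s
        - (s * q s + w s) * (s / h s)) / (h s * h s) =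
       - (s * p s / (r * h s)) - q s * ((1 + s\<^sup>2) - h s * h s) / (h s * h s * h s)"
    using r_pos by (simp add: field_simps power2_eq_square)
  ultimately show ?thesis by (simp add: h_sq)
qed

lemma AB_0: "A 0 = 1" "B 0 = 0"
  by (simp_all add: A_def B_def h_def init)

lemma p_nonneg: "s \<in> {0..N} \<Longrightarrow> 0 \<le> p s"
  using p_pos[of s] init by (cases "s = 0") force+

text \<open>As for a unit vector in a moving orthonormal frame, the sum of the squares of
  \<open>p\<close>, \<open>q\<close> and \<open>w\<close> is conserved.\<close>

lemma p_le_1:
  assumes "s \<in> {0..N}"
  shows "p s \<le> 1"
proof -
  let ?G = "\<lambda>s. p s * p s + q s * q s + w s * w s"
  have "?G s \<le> ?G 0"
  proof (rule within_deriv_nonpos_imp_le[of 0 s "{0..N}" _ "\<lambda>_. 0"])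
    fix x assume x: "x \<in> {0..N}"
    show "(?G has_real_derivative 0) (at x within {0..N})"
      using p_deriv[OF x] q_deriv[OF x] w_deriv[OF x]
      by (auto intro!: derivative_eq_intros simp: algebra_simps)
  qed (use assms in auto)
  then have "p s * p s \<le> 1"
    unfolding init using zero_le_square[of "q s"] zero_le_square[of "w s"] by linarith
  then show ?thesis using abs_le_square_iff[of "p s" 1] p_nonneg[OF assms] by (simp add: power2_eq_square)
qed

lemma A_antimono: "\<lbrakk>0 \<le> s; s \<le> t; t \<le> N\<rbrakk> \<Longrightarrow> A t \<le> A s"
  by (rule within_deriv_nonpos_imp_le[of s t "{0..N}" _ "\<lambda>s. - (p s / (r * h s))"])
     (use A_deriv p_nonneg h_pos r_pos in \<open>auto simp: less_imp_le\<close>)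

lemma B_antimono: "\<lbrakk>0 \<le> s; s \<le> t; t \<le> N\<rbrakk> \<Longrightarrow> B t \<le> B s"
  by (rule within_deriv_nonpos_imp_le[of s t "{0..N}" _ "\<lambda>s. - (s * p s / (r * h s))"])
     (use B_deriv p_nonneg h_pos r_pos in \<open>auto simp: less_imp_le\<close>)

lemma A_le_1: "s \<in> {0..N} \<Longrightarrow> A s \<le> 1"
  using A_antimono[of 0 s] by (simp add: AB_0)

lemma B_nonpos: "s \<in> {0..N} \<Longrightarrow> B s \<le> 0"
  using B_antimono[of 0 s] by (simp add: AB_0)

lemma arsinh_deriv: "(arsinh has_real_derivative 1 / h s) (at s within S)"
  by (auto intro!: derivative_eq_intros simp: h_def add.commute)

text \<open>Since \<open>p\<close> is at most 1, \<open>A\<close> falls no faster than at rate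
  \<open>1 / (r * h s)\<close>, whose integral is the width \<open>arsinh s\<close> of the catenary
  divided by \<open>r\<close>.\<close>

lemma A_lower:
  assumes "s \<in> {0..N}"
  shows "1 - arsinh s / r \<le> A s"
proof -
  have "1 - arsinh s / r - A s \<le> 1 - arsinh 0 / r - A 0"
  proof (rule within_deriv_nonpos_imp_le[of 0 s "{0..N}" _ "\<lambda>s. - (1 / h s) / r + p s / (r * h s)"])
    fix x assume x: "x \<in> {0..N}"
    show "((\<lambda>s. 1 - arsinh s / r - A s) has_real_derivative - (1 / h x) / r + p x / (r * h x)) (at x within {0..N})"
      using A_deriv[OF x] r_pos
      by (auto intro!: derivative_eq_intros simp: h_def add.commute)
  next
    fix x assume "0 < x" "x < s"
    then have "p x \<le> 1" using assms p_le_1 by simp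
    moreover have "- (1 / h x) / r + p x / (r * h x) = (p x - 1) / (r * h x)"
      using r_pos by (simp add: field_simps)
    ultimately show "- (1 / h x) / r + p x / (r * h x) \<le> 0"
      using r_pos h_pos[of x] by (simp add: divide_nonpos_pos)
  qed (use assms in auto)
  then show ?thesis by (simp add: AB_0)
qed

text \<open>
  Seen from the height \<open>h s / r\<close> as angular time, \<open>(p, B)\<close> is a rotating vector driven only by the
  horizontal displacement of the catenary.
\<close>

definition E :: "real \<Rightarrow> real \<Rightarrow> real" where
  "E c s = p s * cos (c - h s / r) + B s * sin (c - h s / r)"

text \<open>The phase turns exactly as fast as \<open>p\<close> and \<open>B\<close> rotate into
  each other, so only the \<open>A\<close> part of the derivative of \<open>p\<close>
  survives.\<close>

lemma E_deriv:
  assumes "s \<in> {0..N}"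
  shows "(E c has_real_derivative A s * cos (c - h s / r) / (r * h s)) (at s within {0..N})"
proof -
  define C D where "C = cos (c - h s / r)" and "D = sin (c - h s / r)"
  have g: "((\<lambda>s. c - h s / r) has_real_derivative - (s / h s / r)) (at s within {0..N})"
    by (use r_pos in \<open>auto intro!: derivative_eq_intros h_deriv\<close>)
  have "(E c has_real_derivative
     (q s / r * C + - D * - (s / h s / r) * p s)
     + (- (s * p s / (r * h s)) * D + C * - (s / h s / r) * B s)) (at s within {0..N})"
    unfolding E_def[abs_def] C_def D_def
    by (intro DERIV_add DERIV_mult p_deriv B_deriv assms
        DERIV_cos[THEN DERIV_chain2] DERIV_sin[THEN DERIV_chain2] g)
  moreover have "(q s / r * C + - D * - (s / h s / r) * p s)
     + (- (s * p s / (r * h s)) * D + C * - (s / h s / r) * B s) = A s * C / (r * h s)"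
    by (subst q_eq) (simp add: divide_inverse algebra_simps)
  ultimately show ?thesis by (simp only: C_def D_def)
qed

section \<open>Contradictions for small and for large radii\<close>

text \<open>Sturm comparison: \<open>?G\<close> is \<open>r\<close> times the Wronskian of
  \<open>p\<close> and \<open>sin (s / r)\<close>. While \<open>A\<close> is nonnegative,
  \<open>w\<close> is nonpositive because \<open>B\<close> is, so \<open>?G\<close> does not
  increase from its initial value 0; at \<open>pi * r\<close> it equals \<open>p\<close>.\<close>

lemma A_neg_half_turn:
  assumes "pi * r \<le> N"
  shows "A (pi * r) < 0"
proof (rule ccontr)
  assume "\<not> A (pi * r) < 0"
  then have A: "0 \<le> A s" if "0 \<le> s" "s \<le> pi * r" for s
    using A_antimono[of s "pi * r"] that assms by simp
  let ?G = "\<lambda>s. q s * sin (s / r) - p s * cos (s / r)"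
  have "?G (pi * r) \<le> ?G 0"
  proof (rule within_deriv_nonpos_imp_le[of 0 "pi * r" "{0..N}" _ "\<lambda>s. w s / (1 + s\<^sup>2) * sin (s / r)"])
    fix x assume x: "x \<in> {0..N}"
    have g: "((\<lambda>s. s / r) has_real_derivative 1 / r) (at x within {0..N})"
      using r_pos by (auto intro!: derivative_eq_intros)
    have "(?G has_real_derivative
       ((w x / (1 + x\<^sup>2) - p x / r) * sin (x / r) + cos (x / r) * (1 / r) * q x)
        - (q x / r * cos (x / r) + - sin (x / r) * (1 / r) * p x)) (at x within {0..N})"
      by (intro DERIV_diff DERIV_mult p_deriv q_deriv x
          DERIV_cos[THEN DERIV_chain2] DERIV_sin[THEN DERIV_chain2] g)
    then show "(?G has_real_derivative w x / (1 + x\<^sup>2) * sin (x / r)) (at x within {0..N})"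
      by (simp add: divide_inverse algebra_simps)
  next
    fix x assume x: "0 < x" "x < pi * r"
    then have "B x \<le> 0" "0 \<le> x * A x" using B_nonpos[of x] A[of x] assms by simp_all
    then have "w x \<le> 0"
      using h_pos[of x] by (subst w_eq) (intro divide_nonpos_pos, simp_all)
    moreover have "0 \<le> sin (x / r)"
      using x r_pos by (intro sin_ge_zero) (auto simp: field_simps)
    ultimately show "w x / (1 + x\<^sup>2) * sin (x / r) \<le> 0"
      by (intro mult_nonpos_nonneg divide_nonpos_nonneg) auto
  qed (use assms r_pos in auto)
  then have "p (pi * r) \<le> 0" using r_pos by (simp add: init)
  then show False using p_pos[of "pi * r"] assms r_pos by simp
qed

text \<open>From arclength \<open>a = pi * r\<close> on, \<open>A\<close> is negative. The phase of
  \<open>E c\<close> is made to run from \<open>pi / 2\<close> to 0 while the height grows by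
  \<open>pi / 2 * r\<close>; the cosine is nonnegative there, so \<open>E c\<close> does not
  increase from \<open>B a\<close> to \<open>p b\<close>, which contradicts
  \<open>p b > 0\<close>.\<close>

lemma small_radius_bound: "N < 1 + 2 * pi * r"
proof (rule ccontr)
  assume "\<not> N < 1 + 2 * pi * r"
  then have N: "1 + 2 * pi * r \<le> N" by simp
  define a where "a = pi * r"
  define Y where "Y = h a + pi / 2 * r"
  \<comment> \<open>The arclength at which height \<open>Y\<close> is reached. As
    \<open>h a \<le> 1 + a\<close>, it is at most \<open>1 + 3/2 * (pi * r)\<close> and so within
    range.\<close>
  define b where "b = sqrt (Y\<^sup>2 - 1)"
  have pr: "0 < pi * r" using r_pos by simp
  have a: "0 < a" "a \<le> N" using N pr by (auto simp: a_def)
  have Y1: "1 \<le> Y" using h_ge1[of a] pr by (simp add: Y_def)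
  then have hb: "h b = Y" by (simp add: h_def b_def)
  have "b \<le> Y" using Y1 by (simp add: b_def real_le_lsqrt)
  moreover have "h a \<le> 1 + a"
    unfolding h_def using a by (intro real_le_lsqrt) (auto simp: power2_eq_square algebra_simps)
  ultimately have bN: "b \<le> N" using N pr by (simp add: Y_def a_def algebra_simps)
  have ab: "a \<le> b"
  proof -
    have "h a \<le> Y" using pr by (simp add: Y_def)
    then have "1 + a\<^sup>2 \<le> Y\<^sup>2" using h_sq[of a] h_pos[of a]
      using power_mono[of "h a" Y 2] by (simp add: power2_eq_square)
    then show ?thesis unfolding b_def by (intro real_le_rsqrt) simp
  qed
  define c where "c = Y / r"
  have "E c b \<le> E c a"
  proof (rule within_deriv_nonpos_imp_le[of a b "{0..N}" _ "\<lambda>s. A s * cos (c - h s / r) / (r * h s)"])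
    fix x assume x: "a < x" "x < b"
    then have A: "A x \<le> 0" using A_neg_half_turn A_antimono[of a x] a bN by (simp add: a_def)
    have "h a \<le> h x" "h x \<le> Y"
      unfolding hb[symmetric] using x a by (auto simp: h_def power_mono)
    moreover have "c - h x / r = (Y - h x) / r" by (simp add: c_def diff_divide_distrib)
    moreover have "(Y - h x) / r \<le> pi / 2"
      using \<open>h a \<le> h x\<close> r_pos by (simp add: pos_divide_le_eq Y_def)
    moreover have "0 \<le> (Y - h x) / r" using \<open>h x \<le> Y\<close> r_pos by simp
    then have "- (pi / 2) \<le> (Y - h x) / r" using pi_gt_zero by linarith
    ultimately have "0 \<le> cos (c - h x / r)"
      by (metis cos_ge_zero)
    then show "A x * cos (c - h x / r) / (r * h x) \<le> 0"
      using A r_pos h_pos[of x] by (intro divide_nonpos_pos mult_nonpos_nonneg mult_pos_pos)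
  qed (use ab a bN in \<open>auto intro: E_deriv\<close>)
  moreover have "E c b = p b" unfolding E_def c_def hb by simp
  moreover have "c - h a / r = pi / 2" using r_pos by (simp add: c_def Y_def field_simps)
  then have "E c a = B a" by (simp only: E_def) simp
  ultimately have "p b \<le> 0" using B_nonpos[of a] a by simp
  then show False using p_pos[of b] ab a bN by simp
qed

text \<open>Height \<open>y\<close> is reached at arclength \<open>sqrt (y\<^sup>2 - 1)\<close>,
  where the width is the inverse hyperbolic cosine of \<open>y\<close>; the logarithmic bounds make
  widths comparable through heights.\<close>

lemma arsinh_height:
  assumes "1 \<le> y"
  shows "h (sqrt (y\<^sup>2 - 1)) = y" "sqrt (y\<^sup>2 - 1) \<le> y"
    "ln y \<le> arsinh (sqrt (y\<^sup>2 - 1))" "arsinh (sqrt (y\<^sup>2 - 1)) \<le> ln (2 * y)"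
proof -
  have y: "1 \<le> y\<^sup>2" using assms by simp
  show "h (sqrt (y\<^sup>2 - 1)) = y" using y assms by (simp add: h_def)
  show le: "sqrt (y\<^sup>2 - 1) \<le> y" using assms by (simp add: real_le_lsqrt)
  have "arsinh (sqrt (y\<^sup>2 - 1)) = ln (sqrt (y\<^sup>2 - 1) + y)"
    using y assms by (simp add: arsinh_real_def)
  moreover have "0 \<le> sqrt (y\<^sup>2 - 1)" using y by simp
  ultimately show "ln y \<le> arsinh (sqrt (y\<^sup>2 - 1))" "arsinh (sqrt (y\<^sup>2 - 1)) \<le> ln (2 * y)"
    using le assms by (auto intro!: ln_mono add_nonneg_pos)
qed

text \<open>With the phase vanishing at height \<open>Y\<close>, it starts at
  \<open>3/5 * pi\<close>, where the cosine is negative. Up to height \<open>Y1\<close>,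
  \<open>E c\<close> loses at least \<open>d / (2 * r)\<close> per unit of width, over a width of at
  least \<open>ln Y1\<close>; afterwards it gains at most \<open>1 / r\<close> per unit, over a
  width of at most \<open>ln 24\<close>. The second assumption says that the loss wins, so
  \<open>p\<close> is nonpositive at height \<open>Y\<close>.\<close>

lemma large_radius_bound:
  assumes "ln (2 + 6/5 * (pi * r)) \<le> r / 2"
    and ln24: "ln 24 \<le> sin (pi / 20) / 2 * ln (1 + pi * r / 20)"
  shows "N < 1 + 3/5 * (pi * r)"
proof (rule ccontr)
  assume "\<not> N < 1 + 3/5 * (pi * r)"
  \<comment> \<open>At height \<open>Y1\<close> the phase has dropped to \<open>11/20 * pi\<close>,
    still beyond the right angle; \<open>d\<close> is minus the cosine there.\<close>
  define Y Y1 where "Y = 1 + 3/5 * (pi * r)" and "Y1 = 1 + pi * r / 20"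
  define a b where "a = sqrt (Y1\<^sup>2 - 1)" and "b = sqrt (Y\<^sup>2 - 1)"
  define d where "d = sin (pi / 20)"
  have N: "Y \<le> N" using \<open>\<not> N < _\<close> by (simp add: Y_def)
  have Y: "1 < Y1" "Y1 < Y" using r_pos by (simp_all add: Y_def Y1_def)
  have ha: "h a = Y1" "ln Y1 \<le> arsinh a"
    using arsinh_height[of Y1] Y by (simp_all add: a_def)
  have hb: "h b = Y" "b \<le> Y" "arsinh b \<le> ln (2 * Y)"
    using arsinh_height[of Y] Y by (simp_all add: b_def)
  have a0: "0 < a" using Y by (simp add: a_def)
  have ab: "a < b" unfolding a_def b_def using Y by (simp add: power_strict_mono)
  have d: "0 < d" unfolding d_def by (intro sin_gt_zero) (use pi_gt_zero in auto)
  have bN: "b \<le> N" using hb N by simp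
  have "arsinh b \<le> r / 2" using hb assms(1) by (simp add: Y_def)
  \<comment> \<open>The first assumption bounds the width up to height \<open>Y\<close> by
    \<open>r / 2\<close>, which \<open>A_lower\<close> turns into this bound.\<close>
  have A_half: "1 / 2 \<le> A s" if s: "0 \<le> s" "s \<le> b" for s
  proof -
    have "arsinh s \<le> r / 2"
      using s \<open>arsinh b \<le> r / 2\<close> arsinh_less_iff_real[of b s] by linarith
    then have "arsinh s / r \<le> 1 / 2" using r_pos by (simp add: field_simps)
    then show ?thesis using A_lower[of s] s bN by simp
  qed
  define c where "c = Y / r"
  have c_eq: "c - h s / r = (Y - h s) / r" for s by (simp add: c_def diff_divide_distrib)
  have first: "E c a + d / (2 * r) * arsinh a \<le> E c 0 + d / (2 * r) * arsinh 0"
  proof (rule within_deriv_nonpos_imp_le[of 0 a "{0..N}" _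
        "\<lambda>s. A s * cos (c - h s / r) / (r * h s) + d / (2 * r) * (1 / h s)"])
    fix x assume "x \<in> {0..N}"
    then show "((\<lambda>s. E c s + d / (2 * r) * arsinh s) has_real_derivative
        A x * cos (c - h x / r) / (r * h x) + d / (2 * r) * (1 / h x)) (at x within {0..N})"
      by (intro DERIV_add DERIV_cmult E_deriv arsinh_deriv)
  next
    fix x assume x: "0 < x" "x < a"
    have "h x \<le> Y1" unfolding ha(1)[symmetric] using x by (simp add: h_def power_mono)
    have "(Y - Y1) / r \<le> (Y - h x) / r"
      using \<open>h x \<le> Y1\<close> r_pos by (intro divide_right_mono) auto
    moreover have "(Y - Y1) / r = 11/20 * pi" using r_pos by (simp add: Y_def Y1_def field_simps)
    moreover have "(Y - h x) / r \<le> (Y - 1) / r"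
      using h_ge1[of x] r_pos by (intro divide_right_mono) auto
    moreover have "(Y - 1) / r = 3/5 * pi" using r_pos by (simp add: Y_def field_simps)
    ultimately have "cos (c - h x / r) \<le> cos (11/20 * pi)"
      unfolding c_eq using pi_gt_zero by (intro cos_monotone_0_pi_le) linarith+
    also have "cos (11/20 * pi) = cos (pi / 20 + pi / 2)" by (rule arg_cong[of _ _ cos]) simp
    also have "\<dots> = - d" unfolding d_def by (simp only: cos_add cos_pi_half sin_pi_half)
    finally have "cos (c - h x / r) \<le> - d" .
    then have "A x * cos (c - h x / r) \<le> A x * - d"
      using A_half[of x] x ab by (intro mult_left_mono) auto
    also have "\<dots> \<le> 1 / 2 * - d"
      using A_half[of x] x ab d by (intro mult_right_mono_neg) auto
    finally have "(A x * cos (c - h x / r) + d / 2) / (r * h x) \<le> 0"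
      using r_pos h_pos[of x] by (intro divide_nonpos_pos mult_pos_pos) auto
    then show "A x * cos (c - h x / r) / (r * h x) + d / (2 * r) * (1 / h x) \<le> 0"
      by (simp add: add_divide_distrib)
  qed (use a0 ab bN in auto)
  \<comment> \<open>Here the cosine may be positive; it and \<open>A\<close> are simply bounded by
    1.\<close>
  have second: "E c b - 1 / r * arsinh b \<le> E c a - 1 / r * arsinh a"
  proof (rule within_deriv_nonpos_imp_le[of a b "{0..N}" _
        "\<lambda>s. A s * cos (c - h s / r) / (r * h s) - 1 / r * (1 / h s)"])
    fix x assume "x \<in> {0..N}"
    then show "((\<lambda>s. E c s - 1 / r * arsinh s) has_real_derivative
        A x * cos (c - h x / r) / (r * h x) - 1 / r * (1 / h x)) (at x within {0..N})"
      by (intro DERIV_diff DERIV_cmult E_deriv arsinh_deriv)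
  next
    fix x assume x: "a < x" "x < b"
    have "A x * cos (c - h x / r) \<le> A x * 1"
      using A_half[of x] x a0 by (intro mult_left_mono) auto
    also have "A x * 1 \<le> 1" using A_le_1[of x] x a0 bN by simp
    finally have "(A x * cos (c - h x / r) - 1) / (r * h x) \<le> 0"
      using r_pos h_pos[of x] by (intro divide_nonpos_pos mult_pos_pos) auto
    then show "A x * cos (c - h x / r) / (r * h x) - 1 / r * (1 / h x) \<le> 0"
      by (simp add: diff_divide_distrib)
  qed (use a0 ab bN in auto)
  have "E c b = p b" unfolding E_def c_def hb(1) by simp
  moreover have "E c 0 = 0" unfolding E_def by (simp add: init AB_0)
  ultimately have "p b \<le> 1 / r * arsinh b - 1 / r * arsinh a - d / (2 * r) * arsinh a"
    using first second by simp
  also have "\<dots> = (arsinh b - (1 + d / 2) * arsinh a) / r"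
    using r_pos by (simp add: field_simps)
  also have "\<dots> \<le> 0"
  proof -
    \<comment> \<open>The factor 24 comes from the coefficients of \<open>pi * r\<close>:
      \<open>6/5\<close> is 24 times \<open>1/20\<close>.\<close>
    have "2 * Y \<le> 24 * Y1" by (simp add: Y_def Y1_def)
    then have "ln (2 * Y) \<le> ln (24 * Y1)" using Y by simp
    also have "\<dots> = ln 24 + ln Y1" using Y by (simp add: ln_mult)
    also have "\<dots> \<le> d / 2 * ln Y1 + ln Y1" using ln24 by (simp add: d_def Y1_def)
    also have "\<dots> = (1 + d / 2) * ln Y1" by (simp add: algebra_simps)
    also have "\<dots> \<le> (1 + d / 2) * arsinh a" using ha(2) d by (intro mult_left_mono) auto
    finally show ?thesis using hb(3) r_pos by (intro divide_nonpos_pos) auto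
  qed
  finally show False using p_pos[of b] a0 ab bN by simp
qed

end

section \<open>Choice of the catenary\<close>

text \<open>\<open>N\<close> is chosen so that \<open>small_radius_bound\<close> excludes all
  \<open>r \<le> M\<close>. For larger \<open>r\<close> both assumptions of
  \<open>large_radius_bound\<close> hold, and the upper bound on \<open>r\<close> makes
  \<open>N\<close> long enough to contradict it.\<close>

lemma no_positive_catenary_development:
  obtains N where "N > 0"
    and "\<And>r p q w. r * (pi * sqrt ((sqrt 17 - 1) / 2)) < 2 * N \<Longrightarrow> \<not> catenary_development N r p q w"
proof -
  define d where "d = sin (pi / 20)"
  have d: "0 < d" unfolding d_def by (intro sin_gt_zero) (use pi_gt_zero in auto)
  \<comment> \<open>The 100 absorbs additive constants; the exponential makes
    \<open>ln (1 + pi * r / 20)\<close> at least \<open>2 * ln 24 / d\<close> once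
    \<open>r > M\<close>.\<close>
  define M where "M = 100 + 20 * exp (2 * ln 24 / d)"
  define N where "N = 1 + 2 * pi * M"
  have M: "M \<ge> 100" by (simp add: M_def)
  have "N > 0" using M by (simp add: N_def add_pos_nonneg)
  moreover have False
    if small: "r * (pi * sqrt ((sqrt 17 - 1) / 2)) < 2 * N" and "catenary_development N r p q w" for r p q w
  proof -
    interpret catenary_development N r p q w by fact
    have "r > M"
    proof (rule ccontr)
      assume "\<not> r > M"
      then have "2 * pi * r \<le> 2 * pi * M" by simp
      then show False using small_radius_bound by (simp add: N_def)
    qed
    have r: "r \<ge> 100" "20 * exp (2 * ln 24 / d) \<le> r" using \<open>r > M\<close> M exp_gt_zero[of "2 * ln 24 / d"] unfolding M_def by linarith+
    have pr: "3 * r \<le> pi * r" "pi * r \<le> 4 * r" using r pi_gt3 pi_less_4 by simp_all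
    \<comment> \<open>The bound \<open>ln t \<le> t - 1\<close> is used after division by 16, which
      brings the slope in \<open>r\<close> down to 3/10 and so below 1/2.\<close>
    have linear: "x \<le> r / 2"
      if "y \<le> (2 + 6/5 * P) / 16 - 1" "y = x - z" "z \<le> 15" "P \<le> 4 * r" for x y z P
      using that r(1) by (simp add: field_simps)
    have "ln ((2 + 6/5 * (pi * r)) / 16) \<le> (2 + 6/5 * (pi * r)) / 16 - 1"
      using r by (intro ln_le_minus_one) (simp add: add_pos_pos)
    moreover have "ln ((2 + 6/5 * (pi * r)) / 16) = ln (2 + 6/5 * (pi * r)) - ln 16"
      using r by (intro ln_divide_pos) (simp_all add: add_pos_pos)
    moreover have "ln (16::real) \<le> 15" using ln_le_minus_one[of "16::real"] by simp
    ultimately have 1: "ln (2 + 6/5 * (pi * r)) \<le> r / 2" using linear pr(2) by blast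
    have "exp (2 * ln 24 / d) \<le> 1 + pi * r / 20" using r pr by linarith
    then have "2 * ln 24 / d \<le> ln (1 + pi * r / 20)"
      using exp_gt_zero[of "2 * ln 24 / d"] by (metis ln_exp ln_le_cancel_iff order_less_le_trans)
    then have 2: "ln 24 \<le> sin (pi / 20) / 2 * ln (1 + pi * r / 20)"
      using d by (simp add: d_def field_simps)
    \<comment> \<open>The factor is at least the square root of 3/2, hence at least 61/50. Thus
      \<open>N\<close> exceeds \<open>61/100 * (pi * r)\<close>, and the surplus over
      \<open>3/5 * (pi * r)\<close> covers the constant 1.\<close>
    have "(4::real) \<le> sqrt 17" by (intro real_le_rsqrt) simp
    then have "61/50 \<le> sqrt ((sqrt 17 - 1) / 2)" by (intro real_le_rsqrt) (simp add: power2_eq_square)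
    then have "pi * r * (61/50) \<le> pi * r * sqrt ((sqrt 17 - 1) / 2)"
      using r by (intro mult_left_mono) auto
    also have "\<dots> = r * (pi * sqrt ((sqrt 17 - 1) / 2))" by simp
    finally have "1 + 3/5 * (pi * r) \<le> N" using small pr r(1) by linarith
    then show False using large_radius_bound[OF 1 2] by simp
  qed
  ultimately show ?thesis using that by blast
qed

section \<open>Self-intersection\<close>

text \<open>Measured in units of \<open>b\<close>, the second half satisfies the equations of a
  development with radius \<open>r / b\<close>, so positivity must fail somewhere. As
  \<open>?p\<close> is positive just after the midpoint, it has a zero, where the curve meets its
  mirror image.\<close>

lemma catenary_sphere_curve_not_inj:
  assumes pos: "0 < N" "0 < b" "0 < r" and T: "T = 2 * b * N"
    and no_dev: "\<And>p q w. \<not> catenary_development N (r / b) p q w"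
    and curv: "\<And>t. t \<in> {0..T} \<Longrightarrow> plane_curvature {0..T} c t = b / (b\<^sup>2 + (t - T / 2)\<^sup>2)"
    and \<gamma>: "sphere_curve r T c \<gamma>"
  shows "\<not> inj_on \<gamma> {0..T}"
proof -
  define u v n where "u t = (1 / r) *\<^sub>R \<gamma> t" and "v = nth_deriv_on {0..T} 1 \<gamma>"
    and "n t = u t \<times> v t" for t
  define \<kappa> where "\<kappa> = plane_curvature {0..T} c"
  have T_pos: "0 < T" using pos T by simp
  interpret sphere_frame r T \<kappa> u v n
    using sphere_curve_frame[OF \<open>0 < r\<close> T_pos \<gamma>] unfolding u_def v_def n_def \<kappa>_def .
  define m where "m = T / 2"
  have m: "m \<in> {0..T}" using T_pos by (simp add: m_def)
  have mN: "m = b * N" using T by (simp add: m_def)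
  have in_T: "m + b * s \<in> {0..T}" if "s \<in> {0..N}" for s
  proof -
    have "0 \<le> b * s" "b * s \<le> b * N" using that pos by simp_all
    then show ?thesis using mN T unfolding atLeastAtMost_iff by linarith
  qed
  have \<kappa>_eq: "b * \<kappa> (m + b * s) = 1 / (1 + s\<^sup>2)" if "s \<in> {0..N}" for s
  proof -
    have "\<kappa> (m + b * s) = b / (b\<^sup>2 + (b * s)\<^sup>2)"
      unfolding \<kappa>_def using curv[OF in_T[OF that]] by (simp add: m_def)
    also have "\<dots> = b / (b * (b * (1 + s\<^sup>2)))" by (simp add: power2_eq_square algebra_simps)
    finally show ?thesis using pos by simp
  qed
  let ?p = "\<lambda>s. u (m + b * s) \<bullet> v m" and ?q = "\<lambda>s. v (m + b * s) \<bullet> v m"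
    and ?w = "\<lambda>s. n (m + b * s) \<bullet> v m"
  have chain: "((\<lambda>s. f (m + b * s) \<bullet> v m) has_real_derivative b * (f' \<bullet> v m)) (at s within {0..N})"
    if "(f has_vector_derivative f') (at (m + b * s) within {0..T})" for f f' s
  proof -
    have "((\<lambda>s. f (m + b * s)) has_vector_derivative b *\<^sub>R f') (at s within {0..N})"
      by (rule vector_diff_chain_within[of "\<lambda>s. m + b * s", unfolded o_def])
         (auto intro!: derivative_eq_intros has_vector_derivative_within_subset[OF that] in_T)
    from has_real_derivative_inner[OF this has_vector_derivative_const, of "v m"] show ?thesis by simp
  qed
  have p: "(?p has_real_derivative ?q s / (r / b)) (at s within {0..N})"
    and q: "(?q has_real_derivative ?w s / (1 + s\<^sup>2) - ?p s / (r / b)) (at s within {0..N})"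
    and w: "(?w has_real_derivative - (?q s / (1 + s\<^sup>2))) (at s within {0..N})"
    if s: "s \<in> {0..N}" for s
  proof -
    have k: "b * (\<kappa> (m + b * s) * z) = z / (1 + s\<^sup>2)" for z
      using \<kappa>_eq[OF s] by (metis mult.assoc mult_1 times_divide_eq_left)
    show "(?p has_real_derivative ?q s / (r / b)) (at s within {0..N})"
      using chain[OF u_deriv[OF in_T[OF s]]] by (simp add: mult.commute)
    show "(?q has_real_derivative ?w s / (1 + s\<^sup>2) - ?p s / (r / b)) (at s within {0..N})"
      using chain[OF v_deriv[OF in_T[OF s]]]
      by (simp add: inner_diff_left right_diff_distrib k mult.commute)
    show "(?w has_real_derivative - (?q s / (1 + s\<^sup>2))) (at s within {0..N})"
      using chain[OF n_deriv[OF in_T[OF s]]] by (simp add: k)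
  qed
  have init: "?p 0 = 0" "?q 0 = 1" "?w 0 = 0"
    using orthonormal[OF m] by (simp_all add: inner_commute)
  have "\<exists>s1\<in>{0<..N}. ?p s1 \<le> 0"
  proof (rule ccontr)
    assume "\<not> ?thesis"
    then have "catenary_development N (r / b) ?p ?q ?w"
      by unfold_locales (use pos p q w init in \<open>auto simp: not_le\<close>)
    then show False using no_dev by blast
  qed
  then obtain s1 where s1: "s1 \<in> {0<..N}" "?p s1 \<le> 0" by blast
  \<comment> \<open>\<open>?p\<close> also vanishes at 0, where the mirror points coincide
    trivially. The positive derivative gives a start \<open>s0 > 0\<close> for the intermediate
    value theorem, hence a genuine double point.\<close>
  have "(?p has_real_derivative b / r) (at 0 within {0..N})"
    using p[of 0] pos init(2) by simp
  from has_real_derivative_pos_inc_right[OF this] obtain d where d: "d > 0"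
    "\<And>h. 0 < h \<Longrightarrow> h \<in> {0..N} \<Longrightarrow> h < d \<Longrightarrow> 0 < ?p h"
    using pos init(1) by auto
  define s0 where "s0 = min (d / 2) s1"
  have s0: "0 < s0" "s0 \<le> s1" "s0 < d" using d s1 by (auto simp: s0_def)
  have "continuous_on {0..N} ?p"
    by (rule DERIV_continuous_on[OF p])
  then have "continuous_on {s0..s1} ?p"
    by (rule continuous_on_subset) (use s0 s1 in auto)
  moreover have "0 \<le> ?p s0" using d(2)[of s0] s0 s1 by simp
  ultimately obtain s where s: "s0 \<le> s" "s \<le> s1" "?p s = 0"
    using IVT2'[of ?p s1 0 s0] s1 s0 by auto
  then have sN: "s \<in> {0<..N}" using s0 s1 by auto
  have bs: "0 < b * s" "b * s \<in> {0..T/2}" using sN pos mN by (auto simp: m_def)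
  have "\<kappa> (T - t) = \<kappa> t" if "t \<in> {0..T}" for t
  proof -
    have "(T - t - T / 2)\<^sup>2 = (t - T / 2)\<^sup>2" by (simp add: power2_eq_square algebra_simps)
    then show ?thesis unfolding \<kappa>_def using curv[of t] curv[of "T - t"] that by simp
  qed
  then have "u (m - b * s) = u (m + b * s)"
    using self_intersection[OF _ bs(2)] s(3) unfolding m_def by blast
  then have "\<gamma> (m - b * s) = \<gamma> (m + b * s)" using pos by (simp add: u_def)
  moreover have "m - b * s \<in> {0..T}" "m + b * s \<in> {0..T}" "m - b * s \<noteq> m + b * s"
    using bs by (auto simp: m_def)
  ultimately show ?thesis unfolding inj_on_def by blast
qed

section \<open>The catenary as a graph\<close>

lemma vector_2_axis: "vector [x, y] = x *\<^sub>R axis 1 1 + y *\<^sub>R (axis 2 1 :: real^2)"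
  by (simp add: vec_eq_iff forall_2 axis_def)

lemma has_vector_derivative_vector_2:
  assumes "(f has_real_derivative f') (at t within S)" "(g has_real_derivative g') (at t within S)"
  shows "((\<lambda>t. vector [f t, g t] :: real^2) has_vector_derivative vector [f', g']) (at t within S)"
  unfolding vector_2_axis using assms
  by (auto intro!: derivative_eq_intros simp: has_real_derivative_iff_has_vector_derivative)

lemma norm_vector_2: "norm (vector [x, y] :: real^2) = sqrt (x\<^sup>2 + y\<^sup>2)"
  by (simp add: norm_vec_def L2_set_def sum_2)

locale catenary =
  fixes b N :: real
  assumes b_pos: "0 < b" and N_pos: "0 < N"
begin

text \<open>\<open>N\<close> is the slope at the right end; each half has arclength
  \<open>b * N\<close> and width \<open>b * arsinh N\<close>. \<open>X\<close> and \<open>D\<close>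
  are abscissa and height as functions of arclength, with the vertex at
  \<open>T / 2\<close>.\<close>

definition T :: real where "T = 2 * b * N"
definition lam :: real where "lam = 2 * b * arsinh N"
definition f :: "real \<Rightarrow> real" where "f x = b * cosh ((x - lam / 2) / b)"
definition X :: "real \<Rightarrow> real" where "X t = lam / 2 + b * arsinh ((t - T / 2) / b)"
definition D :: "real \<Rightarrow> real" where "D t = sqrt (b\<^sup>2 + (t - T / 2)\<^sup>2)"
definition c :: "real \<Rightarrow> real^2" where "c t = vector [X t, D t]"

lemma T_pos: "0 < T" and lam_pos: "0 < lam"
  using b_pos N_pos by (simp_all add: T_def lam_def)

lemma smooth_f: "smooth_on {0..lam} f"
  unfolding smooth_on_def
proof
  fix k
  define G where "G j x = (if even j then b * cosh ((x - lam / 2) / b) else b * sinh ((x - lam / 2) / b)) / b ^ j" for j x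
  have "(G j has_vector_derivative G (Suc j) x) (at x within {0..lam})" for j x
    unfolding G_def has_real_derivative_iff_has_vector_derivative[symmetric] using b_pos
    by (cases "even j") (auto intro!: derivative_eq_intros)
  then have "Ck_on k {0..lam} (G 0)"
    by (intro Ck_on_I lam_pos continuous_on_vector_derivative)
  then show "Ck_on k {0..lam} f" by (simp add: G_def[abs_def] f_def[abs_def])
qed

lemma D_pos: "0 < D t" and D_sq: "(D t)\<^sup>2 = b\<^sup>2 + (t - T / 2)\<^sup>2"
proof -
  have "0 < b\<^sup>2 + (t - T / 2)\<^sup>2" using b_pos by (simp add: add_pos_nonneg)
  then show "0 < D t" "(D t)\<^sup>2 = b\<^sup>2 + (t - T / 2)\<^sup>2" by (simp_all add: D_def)
qed

lemma sqrt_scaled: "sqrt (((t - T / 2) / b)\<^sup>2 + 1) = D t / b"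
proof -
  have "((t - T / 2) / b)\<^sup>2 + 1 = (b\<^sup>2 + (t - T / 2)\<^sup>2) / b\<^sup>2"
    using b_pos by (simp add: field_simps)
  then show ?thesis using b_pos by (simp add: D_def real_sqrt_divide)
qed

lemma f_X: "f (X t) = D t"
  using sqrt_scaled[of t] b_pos by (simp add: f_def X_def cosh_arsinh_real)

lemma D_deriv: "(D has_real_derivative (t - T / 2) / D t) (at t within S)"
  unfolding D_def[abs_def] using D_pos[of t]
  by (auto intro!: derivative_eq_intros simp: D_def field_simps)

lemma c_deriv: "(c has_vector_derivative vector [b / D t, (t - T / 2) / D t]) (at t within S)"
proof -
  have "((\<lambda>t. (t - T / 2) / b) has_real_derivative 1 / b) (at t within S)"
    by (rule DERIV_cdivide) (auto intro!: derivative_eq_intros)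
  from DERIV_chain2[OF arsinh_real_has_field_derivative this]
  have "(X has_real_derivative 0 + b * (1 / (D t / b) * (1 / b))) (at t within S)"
    unfolding X_def[abs_def] sqrt_scaled by (intro DERIV_add DERIV_const DERIV_cmult)
  then have "(X has_real_derivative b / D t) (at t within S)" using b_pos by simp
  then show ?thesis
    unfolding c_def[abs_def] using D_deriv by (rule has_vector_derivative_vector_2)
qed

lemma c_deriv2:
  "((\<lambda>t. vector [b / D t, (t - T / 2) / D t] :: real^2) has_vector_derivative
    vector [- (b * (t - T / 2)) / D t ^ 3, b\<^sup>2 / D t ^ 3]) (at t within S)"
proof (rule has_vector_derivative_vector_2)
  note D = D_pos[of t, THEN less_imp_neq, symmetric]
  show "((\<lambda>t. b / D t) has_real_derivative - (b * (t - T / 2)) / D t ^ 3) (at t within S)"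
    using D by (auto intro!: derivative_eq_intros D_deriv simp: power3_eq_cube)
  have "((\<lambda>t. (t - T / 2) / D t) has_real_derivative
      (D t - (t - T / 2) * ((t - T / 2) / D t)) / (D t * D t)) (at t within S)"
    using D by (auto intro!: derivative_eq_intros D_deriv)
  also have "(D t - (t - T / 2) * ((t - T / 2) / D t)) / (D t * D t)
      = ((D t)\<^sup>2 - (t - T / 2)\<^sup>2) / D t ^ 3"
    using D by (simp add: field_simps power2_eq_square power3_eq_cube)
  also have "\<dots> = b\<^sup>2 / D t ^ 3" by (simp add: D_sq)
  finally show "((\<lambda>t. (t - T / 2) / D t) has_real_derivative b\<^sup>2 / D t ^ 3) (at t within S)" .
qed

lemma c_derivs:
  shows C2_c: "Ck_on 2 {0..T} c"
    and "\<And>t. t \<in> {0..T} \<Longrightarrow> nth_deriv_on {0..T} 1 c t = vector [b / D t, (t - T / 2) / D t]"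
    and "\<And>t. t \<in> {0..T} \<Longrightarrow> nth_deriv_on {0..T} 2 c t =
      vector [- (b * (t - T / 2)) / D t ^ 3, b\<^sup>2 / D t ^ 3]"
proof -
  have "continuous_on {0..T} D" by (rule DERIV_continuous_on[OF D_deriv])
  then have "continuous_on {0..T} (\<lambda>t. vector [- (b * (t - T / 2)) / D t ^ 3, b\<^sup>2 / D t ^ 3] :: real^2)"
    unfolding vector_2_axis using D_pos
    by (intro continuous_intros) (metis less_irrefl power_eq_0_iff)+
  note C2 = C2_on_I[OF T_pos c_deriv c_deriv2 this]
  show "Ck_on 2 {0..T} c" by (rule C2(1))
  show "nth_deriv_on {0..T} 1 c t = vector [b / D t, (t - T / 2) / D t]" if "t \<in> {0..T}" for t
    using that by (rule C2(2))
  show "nth_deriv_on {0..T} 2 c t = vector [- (b * (t - T / 2)) / D t ^ 3, b\<^sup>2 / D t ^ 3]"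
    if "t \<in> {0..T}" for t
    using that by (rule C2(3))
qed

lemma speed: "t \<in> {0..T} \<Longrightarrow> norm (nth_deriv_on {0..T} 1 c t) = 1"
  using D_pos[of t]
  by (simp add: c_derivs norm_vector_2 power_divide D_sq[symmetric] add_divide_distrib[symmetric] del: One_nat_def)

lemma curvature: "t \<in> {0..T} \<Longrightarrow> plane_curvature {0..T} c t = b / (b\<^sup>2 + (t - T / 2)\<^sup>2)"
proof -
  assume t: "t \<in> {0..T}"
  have cross: "b / d * (b\<^sup>2 / d ^ 3) - z / d * (- (b * z) / d ^ 3) = b * (b\<^sup>2 + z\<^sup>2) / d ^ 4"
    for d z :: real
    by (simp add: power2_eq_square power3_eq_cube power4_eq_xxxx add_divide_distrib algebra_simps)
  have "plane_curvature {0..T} c t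
      = b / D t * (b\<^sup>2 / D t ^ 3) - (t - T / 2) / D t * (- (b * (t - T / 2)) / D t ^ 3)"
    using speed[OF t] unfolding plane_curvature_def Let_def c_derivs(2,3)[OF t] by simp
  also have "\<dots> = b * (b\<^sup>2 + (t - T / 2)\<^sup>2) / D t ^ 4"
    by (rule cross)
  also have "\<dots> = b / (D t)\<^sup>2"
    unfolding D_sq[symmetric] using D_pos[of t] by (simp add: field_simps power2_eq_square power4_eq_xxxx)
  finally show ?thesis by (simp add: D_sq)
qed

lemma length_c: "curve_length T c = T"
proof -
  have "curve_length T c = integral {0..T} (\<lambda>_. 1)"
    unfolding curve_length_def by (rule integral_cong) (rule speed)
  then show ?thesis using T_pos by simp
qed

text \<open>The abscissa \<open>X\<close> increases strictly from 0 to \<open>lam\<close>, which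
  gives injectivity; its inverse is explicit through \<open>sinh\<close>, which gives the
  image.\<close>

lemma graph_c: "graph_curve lam f T c"
proof -
  have X_mono: "X s < X t" if "s < t" for s t
    using that b_pos by (simp add: X_def divide_strict_right_mono)
  have X_ends: "X 0 = 0" "X T = lam"
    using b_pos by (simp_all add: X_def T_def lam_def)
  have c_eq: "c t = vector [X t, f (X t)]" for t by (simp add: c_def f_X)
  have "inj_on c {0..T}"
  proof (rule inj_onI)
    fix s t assume "c s = c t"
    then have "X s = X t" by (metis c_def vector_2(1))
    then show "s = t" using X_mono by (metis less_irrefl linorder_neqE_linordered_idom)
  qed
  moreover have "X ` {0..T} = {0..lam}"
  proof
    show "X ` {0..T} \<subseteq> {0..lam}"
    proof
      fix x assume "x \<in> X ` {0..T}"
      then obtain t where t: "0 \<le> t" "t \<le> T" "x = X t" by auto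
      then have "X 0 \<le> x" "x \<le> X T"
        using X_mono[of 0 t] X_mono[of t T] by (auto simp: le_less)
      then show "x \<in> {0..lam}" by (simp add: X_ends)
    qed
    show "{0..lam} \<subseteq> X ` {0..T}"
    proof
      fix x assume x: "x \<in> {0..lam}"
      define t where "t = T / 2 + b * sinh ((x - lam / 2) / b)"
      have "X t = x" using b_pos by (simp add: X_def t_def arsinh_sinh_real)
      moreover have "0 \<le> t" using X_mono[of t 0] x \<open>X t = x\<close> X_ends by (cases "t < 0") auto
      moreover have "t \<le> T" using X_mono[of T t] x \<open>X t = x\<close> X_ends by (cases "T < t") auto
      ultimately show "x \<in> X ` {0..T}" by force
    qed
  qed
  then have "c ` {0..T} = (\<lambda>x. vector [x, f x]) ` {0..lam}"
    by (simp add: c_eq image_image flip: \<open>X ` {0..T} = {0..lam}\<close>)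
  ultimately show ?thesis
    unfolding graph_curve_def unit_speed_on_def
    using T_pos C2_c speed X_ends c_eq by auto
qed

end

section \<open>Scaling the catenary to the prescribed length\<close>

theorem theorem4:
  fixes a T :: real
  defines "a \<equiv> pi * sqrt ((sqrt 17 - 1) / 2)"
  assumes "T > 0"
  shows "\<exists>(lam::real) (f::real \<Rightarrow> real) (L::real) (c::real \<Rightarrow> real^2).
           lam > 0 \<and> smooth_on {0..lam} f \<and> graph_curve lam f L c \<and> curve_length L c = T \<and>
           (\<forall>r. 0 < r \<and> r < T / a \<longrightarrow>
              (\<exists>\<gamma>. sphere_curve r L c \<gamma>) \<and>
              (\<forall>\<gamma>. sphere_curve r L c \<gamma> \<longrightarrow> \<not> inj_on \<gamma> {0..L}))"
proof -
  obtain N where N: "N > 0" and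
    no_dev: "\<And>r p q w. r * a < 2 * N \<Longrightarrow> \<not> catenary_development N r p q w"
    using no_positive_catenary_development unfolding a_def by blast
  \<comment> \<open>The scale that makes the total length \<open>2 * b * N\<close> equal to
    \<open>T\<close>. As \<open>N\<close> is independent of the radius, one catenary serves all
    \<open>r\<close>.\<close>
  define b where "b = T / (2 * N)"
  have "b > 0" using N \<open>T > 0\<close> by (simp add: b_def)
  then interpret cat: catenary b N using N by unfold_locales
  have T: "cat.T = T" unfolding cat.T_def using N by (simp add: b_def)
  have "a > 0" unfolding a_def by simp
  \<comment> \<open>Existence keeps the claim about all such curves from being vacuous.\<close>
  have "\<exists>\<gamma>. sphere_curve r T cat.c \<gamma>" if "0 < r" for r
  proof (rule sphere_curve_exists[OF that \<open>T > 0\<close>])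
    have "b\<^sup>2 + (t - T / 2)\<^sup>2 \<noteq> 0" for t
      using \<open>b > 0\<close> by (simp add: sum_power2_eq_zero_iff)
    then have "continuous_on {0..T} (\<lambda>t. b / (b\<^sup>2 + (t - T / 2)\<^sup>2))"
      by (intro continuous_intros) auto
    then show "continuous_on {0..T} (plane_curvature {0..T} cat.c)"
      using cat.curvature unfolding T by (subst continuous_on_cong) auto
  qed
  moreover have "\<not> inj_on \<gamma> {0..T}" if "0 < r" "r < T / a" "sphere_curve r T cat.c \<gamma>" for r \<gamma>
  proof (rule catenary_sphere_curve_not_inj[OF N \<open>b > 0\<close> \<open>0 < r\<close> _ _ _ that(3)])
    show "T = 2 * b * N" using N by (simp add: b_def)
    \<comment> \<open>This is \<open>r < T / a\<close> in units of \<open>b\<close>.\<close>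
    have "r / b * a < 2 * N"
      using that \<open>a > 0\<close> N \<open>T > 0\<close> by (simp add: b_def field_simps)
    then show "\<not> catenary_development N (r / b) p q w" for p q w by (rule no_dev)
    show "plane_curvature {0..T} cat.c t = b / (b\<^sup>2 + (t - T / 2)\<^sup>2)" if "t \<in> {0..T}" for t
      using cat.curvature that unfolding T .
  qed
  ultimately show ?thesis
    using cat.lam_pos cat.smooth_f cat.graph_c cat.length_c unfolding T by blast
qed

end
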